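(* Let $q\ge5$ and let $G$ be a group of automorphisms of the Payne derived quadrangle $\mathcal{Q}^P$ of $W(q)$ which is contained in $\mathrm{PGL}(4,q)$ and acts regularly on the points of $\mathcal{Q}^P$. Then $G$ is conjugate (within $\mathrm{P\Gamma Sp}(4,q)_P$) to one of the groups in Construction A or Construction E described in the context.
   Context: Let $q=p^m$, $p$ prime. $V=\mathbb{F}_q^4$ carries the alternating form $(x,y)=x_1y_4-x_4y_1+x_2y_3-x_3y_2$; $W(q)$ has all points of $\mathrm{PG}(3,q)$ and the totally isotropic lines; $P=\langle(1,0,0,0)\rangle$. The Payne derived quadrangle $\mathcal{Q}^P$ has points $\langle(a,b,c,1)\rangle$ (points not in $P^\perp$) and as lines the totally isotropic lines not through $P$ and the lines $\langle P,Q\rangle$, $Q\notin P^\perp$. $\mathrm{P\Gamma Sp}(4,q)_P$ is the stabilizer of $P$ in $\mathrm{P\Gamma Sp}(4,q)$. A pair $(A,\sigma)$ denotes the map $x\mapsto x^\sigma A$, product $(A_1,\sigma_1)\circ(A_2,\sigma_2)=(A_1^{\sigma_2}A_2,\sigma_1\sigma_2)$. $E(a,b,c,t)$ is the matrix with rows $(1,0,0,0),(-c,1,0,0),(b-ct,t,1,0),(a,b,c,1)$. Given $T:\mathbb{F}_q^3\to\mathbb{F}_q$ and $\theta$, put $\mathfrak{g}_{a,b,c}=(E(a,b,c,T(a,b,c)),\theta_{a,b,c})$ and $G_{T,\theta}=\{\mathfrak{g}_{a,b,c}\}$. Construction A: $\theta\equiv1$, $T(a,b,c)=S_1(c)$ for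 a reduced linearized polynomial $S_1(X)=\sum_{i=0}^{m-1}s_iX^{p^i}$ over $\mathbb{F}_q$. Construction E: $q=2^m$, $m>1$; $\omega,\mu\in\mathbb{F}_q^*$; $(f_0,\dots,f_{m-1},s_0)\in\mathbb{F}_q^{m+1}$ with $f_0=0$, $\mu f_i=(\mu f_{m-i})^{2^i}$ for $1\le i\le m-1$, and $\sum_{j=1}^{m-1}\omega^{-2^j+1}f_{m-j}^{2^j}=0$; define $s_{i+1}=\sum_{j=1}^{i}\omega^{-2^j+1}f_{i+1-j}^{2^j}+\omega^{-2^{i+1}+1}s_0^{2^{i+1}}$ for $0\le i\le m-2$. Set $\theta\equiv1$ and $T(a,b,c)=\omega\,\mathrm{tr}_{\mathbb{F}_q/\mathbb{F}_2}(\mu^2\omega(a+bc)+\mu b)+\sum_{i=0}^{m-1}s_ic^{2^i}+\omega\sum_{0\le i<j\le m-1}\mu^{2^i}f_{j-i}^{2^i}c^{2^i+2^j}$. *)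

theory Defs
  imports "HOL-Analysis.Analysis" "HOL-Algebra.Bij"
begin

section \<open>The symplectic quadrangle and its Payne derivative\<close>

definition sympl_form :: "'a::field ^ 4 \<Rightarrow> 'a ^ 4 \<Rightarrow> 'a" where
  "sympl_form x y = x $ 1 * y $ 4 - x $ 4 * y $ 1 + x $ 2 * y $ 3 - x $ 3 * y $ 2"

definition pg_points :: "('a::field ^ 4) set set" where
  "pg_points = {U. vec.subspace U \<and> vec.dim U = 1}"

definition pg_lines :: "('a::field ^ 4) set set" where
  "pg_lines = {U. vec.subspace U \<and> vec.dim U = 2}"

definition W_lines :: "('a::field ^ 4) set set" where
  "W_lines = {L \<in> pg_lines. \<forall>x\<in>L. \<forall>y\<in>L. sympl_form x y = 0}"

definition base_point :: "('a::field ^ 4) set" where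
  "base_point = vec.span {vector [1, 0, 0, 0]}"

definition perp :: "('a::field ^ 4) set \<Rightarrow> ('a ^ 4) set" where
  "perp U = {x. \<forall>y\<in>U. sympl_form x y = 0}"

definition payne_points :: "('a::field ^ 4) set set" where
  "payne_points = {Q \<in> pg_points. \<not> Q \<subseteq> perp base_point}"

definition payne_lines :: "('a::field ^ 4) set set" where
  "payne_lines = {L \<in> W_lines. \<not> base_point \<subseteq> L}
     \<union> {vec.span (base_point \<union> Q) | Q. Q \<in> payne_points}"

definition is_payne_automorphism :: "(('a::field ^ 4) set \<Rightarrow> ('a ^ 4) set) \<Rightarrow> bool" where
  "is_payne_automorphism g \<longleftrightarrow>
     bij_betw g payne_points payne_points \<and>
     (\<exists>h. bij_betw h payne_lines payne_lines \<and>
       (\<forall>Q\<in>payne_points. \<forall>L\<in>payne_lines. Q \<subseteq> L \<longleftrightarrow> g Q \<subseteq> h L))"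

definition acts_regularly_on :: "('b \<Rightarrow> 'b) set \<Rightarrow> 'b set \<Rightarrow> bool" where
  "acts_regularly_on G S \<longleftrightarrow> (\<forall>x\<in>S. \<forall>y\<in>S. \<exists>!g. g \<in> G \<and> g x = y)"


section \<open>Collineation groups\<close>

definition field_automorphisms :: "('a::field \<Rightarrow> 'a) set" where
  "field_automorphisms = {\<sigma>. bij \<sigma> \<and>
     (\<forall>x y. \<sigma> (x + y) = \<sigma> x + \<sigma> y) \<and> (\<forall>x y. \<sigma> (x * y) = \<sigma> x * \<sigma> y)}"

definition semilinear :: "'a::field ^ 4 ^ 4 \<Rightarrow> ('a \<Rightarrow> 'a) \<Rightarrow> 'a ^ 4 \<Rightarrow> 'a ^ 4" where
  "semilinear A \<sigma> x = (\<chi> i. \<sigma> (x $ i)) v* A"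

text \<open>Elements of the projective groups are permutations of the points of the projective space,
  that is, elements of \<^term>\<open>BijGroup pg_points\<close>. They are composed as functions, from right to
  left; this is the opposite of composition as right actions, and yields the same subgroups and
  the same conjugacy relation.\<close>

definition collineation ::
    "'a::field ^ 4 ^ 4 \<Rightarrow> ('a \<Rightarrow> 'a) \<Rightarrow> ('a ^ 4) set \<Rightarrow> ('a ^ 4) set" where
  "collineation A \<sigma> = (\<lambda>Q \<in> pg_points. semilinear A \<sigma> ` Q)"

definition PGL4 :: "(('a::field ^ 4) set \<Rightarrow> ('a ^ 4) set) set" where
  "PGL4 = {collineation A id | A. invertible A}"

text \<open>The group of all projective semisimilarities of the form, i.e. the full group of
  collineations of $W(q)$.\<close>

definition PGammaSp4 :: "(('a::field ^ 4) set \<Rightarrow> ('a ^ 4) set) set" where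
  "PGammaSp4 = {collineation A \<sigma> | A \<sigma>. invertible A \<and> \<sigma> \<in> field_automorphisms \<and>
     (\<exists>k. k \<noteq> 0 \<and> (\<forall>x y. sympl_form (semilinear A \<sigma> x) (semilinear A \<sigma> y)
                              = k * \<sigma> (sympl_form x y)))}"

definition PGammaSp4_P :: "(('a::field ^ 4) set \<Rightarrow> ('a ^ 4) set) set" where
  "PGammaSp4_P = {g \<in> PGammaSp4. g base_point = base_point}"

definition conjugate_set :: "('b, 'c) monoid_scheme \<Rightarrow> 'b \<Rightarrow> 'b set \<Rightarrow> 'b set" where
  "conjugate_set M h G = (\<lambda>g. h \<otimes>\<^bsub>M\<^esub> g \<otimes>\<^bsub>M\<^esub> inv\<^bsub>M\<^esub> h) ` G"


section \<open>The two constructions\<close>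

definition E_mat :: "'a::field \<Rightarrow> 'a \<Rightarrow> 'a \<Rightarrow> 'a \<Rightarrow> 'a ^ 4 ^ 4" where
  "E_mat a b c t = vector
     [vector [1, 0, 0, 0],
      vector [- c, 1, 0, 0],
      vector [b - c * t, t, 1, 0],
      vector [a, b, c, 1]]"

definition G_set :: "('a::field \<Rightarrow> 'a \<Rightarrow> 'a \<Rightarrow> 'a) \<Rightarrow> ('a \<Rightarrow> 'a \<Rightarrow> 'a \<Rightarrow> 'a \<Rightarrow> 'a)
    \<Rightarrow> (('a ^ 4) set \<Rightarrow> ('a ^ 4) set) set" where
  "G_set T \<theta> = {collineation (E_mat a b c (T a b c)) (\<theta> a b c) | a b c. True}"

text \<open>In the following, the field has order $p^m$.\<close>

definition constructionA :: "nat \<Rightarrow> nat \<Rightarrow> (('a::field ^ 4) set \<Rightarrow> ('a ^ 4) set) set set" where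
  "constructionA p m =
     {G_set (\<lambda>a b c. \<Sum>i<m. s i * c ^ (p ^ i)) (\<lambda>a b c. id) | s :: nat \<Rightarrow> 'a. True}"

definition trace2 :: "nat \<Rightarrow> 'a::field \<Rightarrow> 'a" where
  "trace2 m x = (\<Sum>i<m. x ^ (2 ^ i))"

definition constructionE_params :: "nat \<Rightarrow> 'a::field \<Rightarrow> 'a \<Rightarrow> (nat \<Rightarrow> 'a) \<Rightarrow> (nat \<Rightarrow> 'a) \<Rightarrow> bool"
  where
  "constructionE_params m \<omega> \<mu> f s \<longleftrightarrow>
     \<omega> \<noteq> 0 \<and> \<mu> \<noteq> 0 \<and> f 0 = 0 \<and>
     (\<forall>i\<in>{1..m - 1}. \<mu> * f i = (\<mu> * f (m - i)) ^ (2 ^ i)) \<and>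
     (\<Sum>j = 1..m - 1. \<omega> powi (- (2 ^ j) + 1) * f (m - j) ^ (2 ^ j)) = 0 \<and>
     (\<forall>i\<in>{0..m - 2}. s (i + 1) =
        (\<Sum>j = 1..i. \<omega> powi (- (2 ^ j) + 1) * f (i + 1 - j) ^ (2 ^ j))
        + \<omega> powi (- (2 ^ (i + 1)) + 1) * s 0 ^ (2 ^ (i + 1)))"

definition constructionE_T ::
    "nat \<Rightarrow> 'a::field \<Rightarrow> 'a \<Rightarrow> (nat \<Rightarrow> 'a) \<Rightarrow> (nat \<Rightarrow> 'a) \<Rightarrow> 'a \<Rightarrow> 'a \<Rightarrow> 'a \<Rightarrow> 'a" where
  "constructionE_T m \<omega> \<mu> f s a b c =
     \<omega> * trace2 m (\<mu>\<^sup>2 * \<omega> * (a + b * c) + \<mu> * b)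
     + (\<Sum>i<m. s i * c ^ (2 ^ i))
     + \<omega> * (\<Sum>(i, j) \<in> {(i, j). i < j \<and> j \<le> m - 1}.
              \<mu> ^ (2 ^ i) * f (j - i) ^ (2 ^ i) * c ^ (2 ^ i + 2 ^ j))"

definition constructionE :: "nat \<Rightarrow> nat \<Rightarrow> (('a::field ^ 4) set \<Rightarrow> ('a ^ 4) set) set set" where
  "constructionE p m =
     {G_set (constructionE_T m \<omega> \<mu> f s) (\<lambda>a b c. id) | (\<omega> :: 'a) \<mu> f s.
        p = 2 \<and> m > 1 \<and> constructionE_params m \<omega> \<mu> f s}"


section \<open>Coordinates\<close>

lemma vector_4 [simp]:
  "(vector [w, x, y, z] :: ('a::zero) ^ 4) $ 1 = w"
  "(vector [w, x, y, z] :: ('a::zero) ^ 4) $ 2 = x"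
  "(vector [w, x, y, z] :: ('a::zero) ^ 4) $ 3 = y"
  "(vector [w, x, y, z] :: ('a::zero) ^ 4) $ 4 = z"
  by (simp_all add: vector_def)

lemma perp_base_point: "perp base_point = {x :: 'a::field ^ 4. x $ 4 = 0}"
proof -
  have "(\<forall>y\<in>base_point. sympl_form x y = 0) \<longleftrightarrow> x $ 4 = 0" for x :: "'a ^ 4"
  proof -
    have "sympl_form x (k *s vector [1, 0, 0, 0]) = - (k * x $ 4)" for k
      by (simp add: sympl_form_def)
    then show ?thesis
      by (auto simp: base_point_def vec.span_singleton intro: spec[where x = 1])
  qed
  then show ?thesis by (simp add: perp_def)
qed

lemma payne_points_eq:
  "payne_points = {vec.span {vector [a, b, c, 1]} | a b c :: 'a::field. True}" (is "_ = ?R")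
proof
  show "payne_points \<subseteq> ?R"
  proof
    fix Q :: "('a ^ 4) set"
    assume Q: "Q \<in> payne_points"
    then have sub: "vec.subspace Q" and dim: "vec.dim Q = 1"
      by (auto simp: payne_points_def pg_points_def)
    from Q obtain x where x: "x \<in> Q" "x $ 4 \<noteq> 0"
      by (auto simp: payne_points_def perp_base_point)
    define v where "v = inverse (x $ 4) *s x"
    have v: "v \<in> Q" "v $ 4 = 1"
      using x sub by (auto simp: v_def vec.subspace_scale)
    have veq: "v = vector [v $ 1, v $ 2, v $ 3, 1]"
      using v by (simp add: vec_eq_iff forall_4)
    have "v \<noteq> 0" using v by auto
    then have "vec.independent {v}" by simp
    then have "Q \<subseteq> vec.span {v}"
      using v dim by (intro vec.card_ge_dim_independent) auto
    moreover have "vec.span {v} \<subseteq> Q"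
      using v sub by (intro vec.span_minimal) auto
    ultimately have "Q = vec.span {vector [v $ 1, v $ 2, v $ 3, 1]}"
      using veq by auto
    then show "Q \<in> ?R" by blast
  qed
next
  show "?R \<subseteq> payne_points"
  proof
    fix Q :: "('a ^ 4) set"
    assume "Q \<in> ?R"
    then obtain a b c where Q: "Q = vec.span {vector [a, b, c, 1]}" by auto
    let ?v = "vector [a, b, c, 1] :: 'a ^ 4"
    have v4: "?v $ 4 = 1" by simp
    then have "?v \<noteq> 0" by (metis zero_index zero_neq_one)
    then have "vec.dim Q = 1"
      unfolding Q by (simp add: vec.dim_eq_card_independent)
    moreover have "?v \<in> Q" unfolding Q by (intro vec.span_base) auto
    ultimately show "Q \<in> payne_points"
      using v4 by (auto simp: payne_points_def pg_points_def perp_base_point Q)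
  qed
qed

end

theory Submission
  imports Defs "HOL-Number_Theory.Residues"
begin

text \<open>
  Linearity forces every element of \<open>G\<close> to be a symplectic similarity fixing the base point, and
  regularity makes \<open>G\<close> a \<open>p\<close>-group, so the lifts with last diagonal entry 1 are unipotent
  symplectic matrices. Their middle 2 by 2 blocks have trace 2 and so do all products of blocks,
  which forces a common fixed row vector; after conjugation all lifts have the form \<open>E(a,b,c,T(a,b,c))\<close>.

  Closure under multiplication turns into a functional equation, which gives
  \<open>T(a,b,c) = \<alpha>(a + bc) + \<beta>(b) + S(c)\<close> with \<open>\<alpha>\<close> and \<open>\<beta>\<close> additive. Comparing parities in \<open>c\<close>
  kills \<open>\<alpha>\<close> and \<open>\<beta>\<close> for odd \<open>p\<close>, and then \<open>S\<close> is additive, that is, a linearized polynomial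
  (Construction A). For \<open>p = 2\<close> and \<open>\<alpha> \<noteq> 0\<close> both maps take a single nonzero value \<open>\<omega>\<close>, hence are
  traces, and \<open>S\<close> is the sum of an additive map and \<open>\<omega>\<close> times an \<open>F\<^sub>2\<close>-valued quadratic form;
  comparing coefficients of linearized polynomials gives the relations of Construction E.
\<close>

section \<open>Linearized polynomials over finite fields\<close>

text \<open>An automorphism of the derived quadrangle might a priori interchange its two kinds of
  lines; a dimension count shows that a linear one preserves isotropy. Regularity gives
  \<open>G\<close> order q^3, and in characteristic p the identity (F - 1)^(p^j) = F^(p^j) - 1 turns
  p-power order into nilpotency. If the middle blocks are 1 + N and 1 + M with N, M nilpotent, trace
  2 of their product says that N M has trace 0, which for 2 by 2 matrices makes N and M
  proportional; this is where the common fixed vector comes from.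

  The obstacle in characteristic two is that the functional equation for \<open>S\<close> is not
  visibly bilinear, since \<open>S z\<close> stands inside the trace. A square root repairs this,
  and the conditions of Construction E then acquire a meaning: the relation between
  \<open>f i\<close> and \<open>f (m - i)\<close> is self-adjointness of an additive map, and the
  formulas for \<open>s\<close> unroll a recurrence around the cyclic index set modulo m.\<close>

lemma power_CARD:
  fixes x :: "'a::{field,finite}"
  shows "x ^ CARD('a) = x"
proof (cases "x = 0")
  case False
  have "x * (\<Prod>y\<in>UNIV-{0}. x * y) = x ^ Suc (CARD('a) - 1) * \<Prod>(UNIV-{0})"
    by (simp add: prod.distrib mult_ac del: Suc_pred)
  also have "Suc (CARD('a) - 1) = CARD('a)"
    by simp
  also have "(\<Prod>y\<in>UNIV-{0}. x * y) = (\<Prod>y\<in>UNIV-{0}. y)"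
    by (rule prod.reindex_bij_witness[of _ "\<lambda>y. y / x" "\<lambda>y. x * y"]) (use False in auto)
  finally show ?thesis
    by simp
qed simp

locale field_of_order =
  fixes ty :: "'a::{field,finite} itself" and p m :: nat
  assumes prime_p: "prime p" and card_field: "CARD('a) = p ^ m"
begin

lemma CHAR_field: "CHAR('a) = p"
proof -
  have "CHAR('a) > 0" by (rule finite_imp_CHAR_pos) simp
  then have "prime CHAR('a)" by (rule prime_CHAR_semidom)
  moreover have "CHAR('a) dvd p ^ m"
    using CHAR_dvd_CARD[where 'a = 'a] card_field by simp
  ultimately show ?thesis
    using prime_p by (metis prime_dvd_power primes_dvd_imp_eq)
qed

lemma p_gt_1: "p > 1"
  using prime_p prime_gt_1_nat by blast

lemma p_eq_0: "of_nat p = (0 :: 'a)"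
  using CHAR_field of_nat_CHAR by metis

lemma m_pos: "m > 0"
proof (rule ccontr)
  assume "\<not> m > 0"
  then have "CARD('a) = 1" using card_field by simp
  then show False by (metis card_1_singletonE UNIV_I singletonD zero_neq_one)
qed

lemma frob_add: "(x + y :: 'a) ^ p ^ i = x ^ p ^ i + y ^ p ^ i"
  using freshmans_dream'[where 'a = 'a] CHAR_field prime_p by metis

lemma frob_sum: "(\<Sum>k\<in>A. g k :: 'a) ^ p ^ i = (\<Sum>k\<in>A. g k ^ p ^ i)"
  using freshmans_dream_sum'[where 'a = 'a] CHAR_field prime_p by metis

lemma frob_m: "(x :: 'a) ^ p ^ m = x"
  using power_CARD[of x] card_field by simp

lemma frob_add_m: "(x :: 'a) ^ p ^ (i + m) = x ^ p ^ i"
  by (metis frob_m mult.commute power_add power_mult)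

lemma frob_frob: "((x :: 'a) ^ p ^ i) ^ p ^ j = x ^ p ^ (i + j)"
  by (simp add: power_add power_mult)

text \<open>Both sides come from polynomials of degree at most \<open>p ^ (m - 1)\<close>, less than
  the number of field elements, so equal values force equal coefficients.\<close>

lemma linearized_unique:
  fixes a b :: "nat \<Rightarrow> 'a"
  assumes "\<And>z. (\<Sum>i<m. a i * z ^ p ^ i) = (\<Sum>i<m. b i * z ^ p ^ i)" and "i < m"
  shows "a i = b i"
proof -
  let ?P = "\<lambda>a. \<Sum>i<m. Polynomial.monom (a i) (p ^ i)"
  have deg: "degree (?P a) < CARD('a)" for a :: "nat \<Rightarrow> 'a"
  proof -
    have "degree (?P a) \<le> p ^ (m - 1)"
    proof (intro degree_sum_le)
      fix i assume "i \<in> {..<m}"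
      then have "p ^ i \<le> p ^ (m - 1)" using p_gt_1 by (intro power_increasing) auto
      then show "degree (Polynomial.monom (a i) (p ^ i)) \<le> p ^ (m - 1)"
        by (meson degree_monom_le le_trans)
    qed simp
    also have "\<dots> < p ^ m" using p_gt_1 m_pos by (intro power_strict_increasing) auto
    finally show ?thesis using card_field by simp
  qed
  have "?P a = ?P b"
    using assms(1) deg
    by (intro poly_eqI_degree[of UNIV]) (simp_all add: poly_sum poly_monom)
  moreover have "Polynomial.coeff (?P c) (p ^ i) = c i" for c :: "nat \<Rightarrow> 'a"
  proof -
    have "Polynomial.coeff (?P c) (p ^ i) = (\<Sum>j<m. if j = i then c j else 0)"
      using p_gt_1 by (simp add: coeff_sum)
    also have "\<dots> = c i"
      using assms(2) by simp
    finally show ?thesis .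
  qed
  ultimately show ?thesis by metis
qed

lemma interpolating_poly:
  fixes S :: "'a \<Rightarrow> 'a"
  obtains P where "\<And>x. poly P x = S x" "degree P < p ^ m"
proof
  \<comment> \<open>Lagrange interpolation: with q the field order, 1 - (x - y)^(q - 1) is the
    indicator function of \<open>y\<close>.\<close>
  define P where "P = (\<Sum>y\<in>UNIV. Polynomial.smult (S y) (1 - [:- y, 1:] ^ (CARD('a) - 1)))"
  have pw: "x ^ (CARD('a) - 1) = 1" if "x \<noteq> 0" for x :: 'a
  proof -
    have "x * x ^ (CARD('a) - 1) = x"
      using power_CARD[of x] by (metis Suc_pred' power_Suc zero_less_card_finite)
    then show ?thesis using that by simp
  qed
  have card: "CARD('a) - 1 > 0"
    using one_less_power[of p m] card_field p_gt_1 m_pos by simp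
  show "poly P x = S x" for x
  proof -
    have "poly P x = (\<Sum>y\<in>UNIV. S y * (1 - (x - y) ^ (CARD('a) - 1)))"
      by (simp add: P_def poly_sum poly_power)
    also have "\<dots> = (\<Sum>y\<in>UNIV. if y = x then S y else 0)"
      using pw card by (intro sum.cong) (auto simp: power_0_left)
    finally show ?thesis by simp
  qed
  have "degree P \<le> CARD('a) - 1"
    unfolding P_def
  proof (intro degree_sum_le)
    fix y :: 'a
    have "degree ([:- y, 1:] ^ (CARD('a) - 1)) \<le> CARD('a) - 1"
      using degree_power_le[of "[:- y, 1:]" "CARD('a) - 1"] by simp
    then have "degree (1 - [:- y, 1:] ^ (CARD('a) - 1)) \<le> CARD('a) - 1"
      by (intro degree_diff_le) simp_all
    then show "degree (Polynomial.smult (S y) (1 - [:- y, 1:] ^ (CARD('a) - 1))) \<le> CARD('a) - 1"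
      using degree_smult_le le_trans by blast
  qed simp
  then show "degree P < p ^ m"
    using card card_field by linarith
qed

text \<open>Additivity makes the derivative translation invariant, hence constant. Therefore, up to the
  linear term, the polynomial is a polynomial in the \<open>p\<close>-th power, which is additive of smaller degree.\<close>

lemma additive_poly_linearized:
  fixes P :: "'a poly"
  assumes "k \<le> m" "degree P < p ^ k" "\<And>x y. poly P (x + y) = poly P x + poly P y"
  shows "\<exists>s. \<forall>x. poly P x = (\<Sum>i<k. s i * x ^ p ^ i)"
  using assms
proof (induction k arbitrary: P)
  case 0
  then have "degree P = 0" by simp
  then obtain c where "P = [:c:]" by (rule degree_eq_zeroE)
  moreover from this "0.prems"(3)[of 0 0] have "c + c = c + 0" by simp
  then have "c = 0" by (rule add_left_imp_eq)
  ultimately show ?case by simp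
next
  case (Suc k)
  \<comment> \<open>This bound keeps all degrees below the field order, so identities of values may
    be read as identities of polynomials and then differentiated.\<close>
  have le: "p ^ Suc k \<le> CARD('a)"
    unfolding card_field using Suc.prems(1) p_gt_1 by (intro power_increasing) auto
  have "pderiv P = [:Polynomial.coeff P 1:]"
  proof (rule poly_eqI_degree[of UNIV])
    fix y :: 'a
    have "P \<circ>\<^sub>p [:y, 1:] = P + [:poly P y:]"
    proof (rule poly_eqI_degree[of UNIV])
      show "poly (P \<circ>\<^sub>p [:y, 1:]) x = poly (P + [:poly P y:]) x" for x
        using Suc.prems(3) by (simp add: poly_pcompose add.commute)
      show "degree (P \<circ>\<^sub>p [:y, 1:]) < card (UNIV :: 'a set)"
        using Suc.prems(2) le by (simp add: degree_pcompose)
      show "degree (P + [:poly P y:]) < card (UNIV :: 'a set)"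
        using Suc.prems(2) le by (intro degree_add_less) (simp_all)
    qed
    then have "pderiv (P \<circ>\<^sub>p [:y, 1:]) = pderiv (P + [:poly P y:])" by simp
    then have "pderiv P \<circ>\<^sub>p [:y, 1:] = pderiv P"
      by (simp add: pderiv_pcompose pderiv_add pderiv_pCons)
    \<comment> \<open>At 0 the translated derivative takes the value of the derivative at
      \<open>y\<close>, which is therefore independent of \<open>y\<close>.\<close>
    then have "poly (pderiv P \<circ>\<^sub>p [:y, 1:]) 0 = poly (pderiv P) 0" by simp
    then show "poly (pderiv P) y = poly [:Polynomial.coeff P 1:] y"
      by (simp add: poly_pcompose poly_0_coeff_0 coeff_pderiv)
  next
    have "degree (pderiv P) \<le> degree P"
      by (intro degree_le) (simp add: coeff_pderiv coeff_eq_0)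
    then show "degree (pderiv P) < card (UNIV :: 'a set)"
      using Suc.prems(2) le by linarith
  qed simp
  then have "Polynomial.coeff (pderiv P) n = (if n = 0 then Polynomial.coeff P 1 else 0)" for n
    by (simp add: coeff_pCons split: nat.split)
  then have zero: "Polynomial.coeff P n = 0" if "n \<noteq> 1" "\<not> p dvd n" for n
  proof -
    have "n \<noteq> 0" using that by (metis dvd_0_right)
    then obtain n' where n': "n = Suc n'" using not0_implies_Suc by blast
    have "of_nat n * Polynomial.coeff P n = 0"
      using \<open>\<And>n. Polynomial.coeff (pderiv P) n = _ n\<close>[of n'] that unfolding n' coeff_pderiv by simp
    moreover have "of_nat n \<noteq> (0 :: 'a)"
      using that CHAR_field by (simp add: of_nat_eq_0_iff_char_dvd)
    ultimately show ?thesis by simp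
  qed
  define R where "R = (\<Sum>j<p ^ k. Polynomial.monom (Polynomial.coeff P (p * j)) j)"
  have PR: "poly P x = Polynomial.coeff P 1 * x + poly R (x ^ p)" for x
  proof -
    have "poly P x = (\<Sum>n<p ^ Suc k. Polynomial.coeff P n * x ^ n)"
      unfolding poly_altdef using Suc.prems(2)
      by (intro sum.mono_neutral_left) (auto simp: not_le coeff_eq_0)
    also have "\<dots> = (\<Sum>n\<in>insert 1 ((\<lambda>j. p * j) ` {..<p ^ k}). Polynomial.coeff P n * x ^ n)"
    proof (intro sum.mono_neutral_right)
      show "insert 1 ((\<lambda>j. p * j) ` {..<p ^ k}) \<subseteq> {..<p ^ Suc k}"
        using p_gt_1 one_less_power[of p "Suc k"] by auto
      show "\<forall>n\<in>{..<p ^ Suc k} - insert 1 ((\<lambda>j. p * j) ` {..<p ^ k}). Polynomial.coeff P n * x ^ n =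
          0"
      proof
        fix n assume n: "n \<in> {..<p ^ Suc k} - insert 1 ((\<lambda>j. p * j) ` {..<p ^ k})"
        have "\<not> p dvd n"
        proof
          assume "p dvd n"
          then obtain j where "n = p * j" by auto
          with n p_gt_1 have "j < p ^ k" by auto
          with n \<open>n = p * j\<close> show False by auto
        qed
        then show "Polynomial.coeff P n * x ^ n = 0" using zero n by simp
      qed
    qed simp
    also have "\<dots> = Polynomial.coeff P 1 * x + (\<Sum>n\<in>(\<lambda>j. p * j) ` {..<p ^ k}. Polynomial.coeff P n * x
        ^ n)"
    proof -
      have "1 \<notin> (\<lambda>j. p * j) ` {..<p ^ k}"
      proof
        assume "1 \<in> (\<lambda>j. p * j) ` {..<p ^ k}"
        then have "p dvd 1" by (metis dvd_triv_left imageE)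
        then show False using p_gt_1 by simp
      qed
      then show ?thesis
        by (simp only: sum.insert[OF finite_imageI[OF finite_lessThan]] power_one_right
            not_False_eq_True)
    qed
    also have "(\<Sum>n\<in>(\<lambda>j. p * j) ` {..<p ^ k}. Polynomial.coeff P n * x ^ n)
        = (\<Sum>j<p ^ k. Polynomial.coeff P (p * j) * x ^ (p * j))"
      using p_gt_1 by (subst sum.reindex) (auto simp: inj_on_def)
    also have "\<dots> = poly R (x ^ p)"
      by (simp add: R_def poly_sum poly_monom power_mult)
    finally show ?thesis .
  qed
  \<comment> \<open>Every element is a p-th power, so additivity of \<open>R\<close> at p-th powers
    is additivity everywhere.\<close>
  have frob_surj: "\<exists>x'. x = x' ^ p" for x :: 'a
    by (rule exI[of _ "x ^ p ^ (m - 1)"])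
       (metis Suc_pred' frob_m m_pos power_Suc2 power_mult)
  have addR: "poly R (x + y) = poly R x + poly R y" for x y
  proof -
    obtain x' y' where "x = x' ^ p" "y = y' ^ p" using frob_surj by metis
    moreover have "(x' + y') ^ p = x' ^ p + y' ^ p" using frob_add[of x' y' 1] by simp
    ultimately show ?thesis
      using Suc.prems(3)[of x' y'] PR by (simp add: algebra_simps)
  qed
  have degR: "degree R < p ^ k"
  proof -
    have "degree R \<le> p ^ k - 1"
      unfolding R_def
    proof (intro degree_sum_le)
      fix j assume "j \<in> {..<p ^ k}"
      then show "degree (Polynomial.monom (Polynomial.coeff P (p * j)) j) \<le> p ^ k - 1"
        using degree_monom_le[of "Polynomial.coeff P (p * j)" j] by simp
    qed simp
    moreover have "p ^ k > 0" using p_gt_1 by simp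
    ultimately show ?thesis by linarith
  qed
  obtain s where s: "\<forall>x. poly R x = (\<Sum>i<k. s i * x ^ p ^ i)"
    using Suc.IH[OF _ degR addR] Suc.prems(1) by auto
  \<comment> \<open>Substituting \<open>x ^ p\<close> shifts the coefficients of \<open>R\<close> by
    one index; the linear coefficient of \<open>P\<close> fills index 0.\<close>
  have "poly P x = (\<Sum>i<Suc k. (case i of 0 \<Rightarrow> Polynomial.coeff P 1 | Suc i \<Rightarrow> s i) * x ^ p ^ i)" for x
    unfolding PR s[rule_format] by (simp add: sum.lessThan_Suc_shift power_mult mult.commute
        del: sum.lessThan_Suc)
  then show ?case by blast
qed

lemma additive_linearized:
  fixes S :: "'a \<Rightarrow> 'a"
  assumes "\<And>x y. S (x + y) = S x + S y"
  obtains s where "\<And>x. S x = (\<Sum>i<m. s i * x ^ p ^ i)"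
proof -
  obtain P where "\<And>x. poly P x = S x" "degree P < p ^ m" using interpolating_poly by blast
  then show thesis using additive_poly_linearized[of m P] assms that by auto
qed

end

section \<open>Traces and quadratic forms in characteristic two\<close>

locale binary_field = field_of_order ty 2 m for ty :: "'a::{field,finite} itself" and m
begin

lemma double_eq_0 [simp]: "x + x = (0 :: 'a)"
  using p_eq_0 by (metis mult_2 mult_zero_left of_nat_numeral)

lemma uminus_eq [simp]: "- x = (x :: 'a)"
  by (rule minus_unique) simp

lemma minus_eq_plus [simp]: "x - y = x + (y :: 'a)"
  by (metis diff_conv_add_uminus uminus_eq)

lemma double_cancel [simp]: "x + (x + y) = (y :: 'a)"
  by (metis add.assoc add_0 double_eq_0)

lemma add_eq_0_iff_eq: "x + y = 0 \<longleftrightarrow> x = (y :: 'a)"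
  by (metis double_eq_0 add_left_cancel)

lemma square_add: "(x + y :: 'a)\<^sup>2 = x\<^sup>2 + y\<^sup>2"
  using frob_add[of x y 1] by simp

lemma square_sum: "(\<Sum>k\<in>A. g k :: 'a)\<^sup>2 = (\<Sum>k\<in>A. (g k)\<^sup>2)"
  using frob_sum[of g A 1] by simp

lemma square_frob: "((x :: 'a) ^ 2 ^ i)\<^sup>2 = x ^ 2 ^ Suc i"
  by (metis power_Suc2 power_mult)

lemma square_root: "((x :: 'a) ^ 2 ^ (m - 1))\<^sup>2 = x"
proof -
  have "(x ^ 2 ^ (m - 1))\<^sup>2 = x ^ 2 ^ m"
    using m_pos by (metis Suc_pred' power_Suc2 power_mult)
  then show ?thesis using frob_m by simp
qed

section \<open>The absolute trace\<close>

lemma trace_add: "trace2 m (x + y :: 'a) = trace2 m x + trace2 m y"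
  by (simp add: trace2_def frob_add sum.distrib)

lemma trace_sum: "trace2 m (\<Sum>k\<in>A. g k :: 'a) = (\<Sum>k\<in>A. trace2 m (g k))"
  unfolding trace2_def frob_sum by (rule sum.swap)

text \<open>Squaring permutes the summands cyclically, because \<open>x ^ 2 ^ m = x\<close>.\<close>

lemma trace_square: "trace2 m ((x :: 'a)\<^sup>2) = trace2 m x"
proof -
  let ?g = "\<lambda>i. x ^ 2 ^ i"
  have "?g 0 + (\<Sum>i<m. ?g (Suc i)) = (\<Sum>i<m. ?g i) + ?g m"
    by (rule trans[OF sum.lessThan_Suc_shift[symmetric] sum.lessThan_Suc])
  then have "(\<Sum>i<m. ?g (Suc i)) = (\<Sum>i<m. ?g i)"
    using frob_m[of x] by (simp add: add.commute)
  then show ?thesis by (simp add: trace2_def power_mult)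
qed

lemma trace_frob: "trace2 m ((x :: 'a) ^ 2 ^ k) = trace2 m x"
  by (induction k) (simp_all add: power_mult mult.commute[of 2] trace_square)

text \<open>As a function of \<open>c\<close>, the trace of \<open>c * x\<close> is a linearized
  polynomial whose coefficient at index 0 is \<open>x\<close>.\<close>

lemma trace_nondegenerate:
  assumes "\<And>c. trace2 m (c * x) = trace2 m (c * (y :: 'a))"
  shows "x = y"
proof -
  have "(\<Sum>i<m. x ^ 2 ^ i * c ^ 2 ^ i) = (\<Sum>i<m. y ^ 2 ^ i * c ^ 2 ^ i)" for c
    using assms[of c] by (simp add: trace2_def power_mult_distrib mult.commute)
  from linearized_unique[OF this m_pos] show ?thesis by simp
qed

text \<open>Frobenius moves each coefficient one place up, wrapping from \<open>m - 1\<close> to 0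
  since \<open>z ^ 2 ^ m = z\<close>. In this form identities involving squares can be compared by
  \<open>linearized_unique\<close>.\<close>

lemma square_linearized:
  fixes a :: "nat \<Rightarrow> 'a"
  shows "(\<Sum>i<m. a i * z ^ 2 ^ i)\<^sup>2 = (\<Sum>i<m. (a (if i = 0 then m - 1 else i - 1))\<^sup>2 * z ^ 2 ^ i)"
proof -
  have sq: "(\<Sum>i<m. a i * z ^ 2 ^ i)\<^sup>2 = (\<Sum>i<m. (a i)\<^sup>2 * z ^ 2 ^ Suc i)"
    by (simp only: square_sum power_mult_distrib square_frob)
  have z: "z ^ (2 * 2 ^ (m - Suc 0)) = z"
    using m_pos frob_m[of z] by (metis One_nat_def Suc_pred' power_Suc)
  have "(\<Sum>i<m. (a i)\<^sup>2 * z ^ 2 ^ Suc i)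
      = (\<Sum>i<m. (a (if i = 0 then m - 1 else i - 1))\<^sup>2 * z ^ 2 ^ i)"
    by (rule sum.reindex_bij_witness[of _ "\<lambda>i. if i = 0 then m - 1 else i - 1"
          "\<lambda>i. if i = m - 1 then 0 else Suc i"])
       (use m_pos z in \<open>auto split: if_splits\<close>)
  with sq show ?thesis by (rule trans)
qed

text \<open>After division by \<omega> the values are 0 and 1, hence fixed by squaring. Comparing
  coefficients gives \<open>k i = (k (i - 1))\<^sup>2\<close>, the pattern of a trace with \<kappa>
  equal to \<open>k 0\<close>.\<close>

lemma two_valued_additive:
  fixes \<alpha> :: "'a \<Rightarrow> 'a"
  assumes add: "\<And>x y. \<alpha> (x + y) = \<alpha> x + \<alpha> y" and "\<omega> \<noteq> 0"
    and two: "\<And>x. \<alpha> x = 0 \<or> \<alpha> x = \<omega>"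
  obtains \<kappa> where "\<And>v. \<alpha> v = \<omega> * trace2 m (\<kappa> * v)"
proof -
  define \<psi> where "\<psi> v = \<alpha> v / \<omega>" for v
  have sq: "(\<psi> v)\<^sup>2 = \<psi> v" for v
    using two[of v] \<open>\<omega> \<noteq> 0\<close> by (auto simp: \<psi>_def)
  obtain k where k: "\<And>v. \<psi> v = (\<Sum>i<m. k i * v ^ 2 ^ i)"
    by (rule additive_linearized[of \<psi>]) (auto simp: \<psi>_def add add_divide_distrib)
  have "(\<Sum>i<m. (k (if i = 0 then m - 1 else i - 1))\<^sup>2 * v ^ 2 ^ i) = (\<Sum>i<m. k i * v ^ 2 ^ i)" for v
    using sq[of v] unfolding k square_linearized .
  from linearized_unique[OF this] have rec: "k i = (k (i - 1))\<^sup>2" if "i < m" "i > 0" for i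
    using that by fastforce
  have ki: "k i = k 0 ^ 2 ^ i" if "i < m" for i
    using that
  proof (induction i)
    case (Suc i)
    then show ?case using rec[of "Suc i"] by (simp only: square_frob) (simp add: square_frob del:
        power_Suc)
  qed simp
  have "\<psi> v = trace2 m (k 0 * v)" for v
    unfolding k trace2_def power_mult_distrib by (intro sum.cong refl) (metis ki lessThan_iff)
  moreover have "\<alpha> v = \<omega> * \<psi> v" for v
    using \<open>\<omega> \<noteq> 0\<close> by (simp add: \<psi>_def)
  ultimately show thesis by (intro that[of "k 0"]) metis
qed

text \<open>The adjoint of \<open>l i * z ^ 2 ^ i\<close> for the trace form is
  \<open>(l i * z) ^ 2 ^ (m - i)\<close>; by nondegeneracy a self-adjoint map has the same
  coefficients as its adjoint.\<close>

lemma self_adjoint_coeffs: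
  fixes l :: "nat \<Rightarrow> 'a"
  assumes "\<And>c z. trace2 m (c * (\<Sum>i<m. l i * z ^ 2 ^ i)) = trace2 m (z * (\<Sum>i<m. l i * c ^ 2 ^ i))"
    and "1 \<le> i" "i < m"
  shows "l i = l (m - i) ^ 2 ^ i"
proof -
  \<comment> \<open>Negation of indices modulo \<open>m\<close>; 0 is separate because
    \<open>m - 0\<close> lies outside the range.\<close>
  let ?r = "\<lambda>i. if i = 0 then 0 else m - i"
  have "(\<Sum>i<m. l i * z ^ 2 ^ i) = (\<Sum>i<m. l (?r i) ^ 2 ^ i * z ^ 2 ^ i)" for z
  proof (rule trace_nondegenerate)
    fix c
    have "trace2 m (c * (\<Sum>i<m. l i * z ^ 2 ^ i)) = trace2 m (z * (\<Sum>i<m. l i * c ^ 2 ^ i))"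
      by (rule assms)
    also have "\<dots> = (\<Sum>i<m. trace2 m (z * (l i * c ^ 2 ^ i)))"
      by (simp add: sum_distrib_left trace_sum)
    also have "\<dots> = (\<Sum>i<m. trace2 m (c * (l i ^ 2 ^ (m - i) * z ^ 2 ^ (m - i))))"
    proof (intro sum.cong refl)
      fix i assume "i \<in> {..<m}"
      then have "(c ^ 2 ^ i) ^ 2 ^ (m - i) = c" by (simp add: frob_frob frob_m)
      then have "(z * (l i * c ^ 2 ^ i)) ^ 2 ^ (m - i) = c * (l i ^ 2 ^ (m - i) * z ^ 2 ^ (m - i))"
        by (simp add: power_mult_distrib mult_ac)
      then show "trace2 m (z * (l i * c ^ 2 ^ i)) = trace2 m (c * (l i ^ 2 ^ (m - i) * z ^ 2 ^ (m -
          i)))"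
        by (metis trace_frob)
    qed
    also have "\<dots> = trace2 m (c * (\<Sum>i<m. l i ^ 2 ^ (m - i) * z ^ 2 ^ (m - i)))"
      by (simp add: sum_distrib_left trace_sum)
    also have "(\<Sum>i<m. l i ^ 2 ^ (m - i) * z ^ 2 ^ (m - i)) = (\<Sum>i<m. l (?r i) ^ 2 ^ i * z ^ 2 ^ i)"
      by (rule sum.reindex_bij_witness[of _ ?r ?r]) (auto simp: frob_m)
    finally show "trace2 m (c * (\<Sum>i<m. l i * z ^ 2 ^ i))
      = trace2 m (c * (\<Sum>i<m. l (?r i) ^ 2 ^ i * z ^ 2 ^ i))" .
  qed
  from linearized_unique[OF this \<open>i < m\<close>] show ?thesis using assms(2) by simp
qed

text \<open>With \<open>l i = \<mu> * f i\<close> this is the last sum of Construction E without its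
  factor \<omega>. For self-adjoint coefficients it is a quadratic form over the field with two
  elements.\<close>

definition trace_quadratic :: "(nat \<Rightarrow> 'a) \<Rightarrow> 'a \<Rightarrow> 'a" where
  "trace_quadratic l c = (\<Sum>(i, j) \<in> {(i, j). i < j \<and> j < m}. l (j - i) ^ 2 ^ i * c ^ (2 ^ i + 2 ^
      j))"

text \<open>The self-adjointness condition matches the two halves of the mixed terms with the index pairs
  \<open>i + k < m\<close> and \<open>i + k \<ge> m\<close> of the full trace.\<close>

lemma trace_quadratic_polar:
  fixes l :: "nat \<Rightarrow> 'a"
  assumes l: "\<And>i. 1 \<le> i \<Longrightarrow> i < m \<Longrightarrow> l i = l (m - i) ^ 2 ^ i"
  shows "trace_quadratic l (c + z) = trace_quadratic l c + trace_quadratic l z + trace2 m (c *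
      (\<Sum>k=1..<m. l k * z ^ 2 ^ k))"
proof -
  let ?P = "{(i, j). i < j \<and> j < m}"
  let ?A = "\<lambda>(i, j). l (j - i) ^ 2 ^ i * c ^ 2 ^ i * z ^ 2 ^ j"
  let ?B = "\<lambda>(i, j). l (j - i) ^ 2 ^ i * c ^ 2 ^ j * z ^ 2 ^ i"
  let ?g = "\<lambda>(i, k). (c * (l k * z ^ 2 ^ k)) ^ 2 ^ i"
  let ?I = "{(i, k). i < m \<and> 1 \<le> k \<and> i + k < m}"
  let ?J = "{(i, k). i < m \<and> k < m \<and> m \<le> i + k}"
  have "trace_quadratic l (c + z) = (\<Sum>(i, j)\<in>?P. l (j - i) ^ 2 ^ i * ((c ^ 2 ^ i + z ^ 2 ^ i) * (c ^
      2 ^ j + z ^ 2 ^ j)))"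
    unfolding trace_quadratic_def by (simp add: power_add frob_add)
  also have "\<dots> = trace_quadratic l c + trace_quadratic l z + (sum ?A ?P + sum ?B ?P)"
    unfolding trace_quadratic_def sum.distrib[symmetric]
    by (intro sum.cong refl) (auto simp: power_add algebra_simps)
  also have "sum ?A ?P = sum ?g ?I"
    by (rule sum.reindex_bij_witness[of _ "\<lambda>(i, k). (i, i + k)" "\<lambda>(i, j). (i, j - i)"])
       (auto simp: power_mult_distrib frob_frob)
  also have "sum ?B ?P = sum ?g ?J"
  proof (rule sum.reindex_bij_witness[of _ "\<lambda>(i, k). (i + k - m, i)" "\<lambda>(i, j). (j, m - (j - i))"])
    fix x assume "x \<in> ?P"
    then obtain i j where x: "x = (i, j)" "i < j" "j < m" by auto
    let ?k = "m - (j - i)"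
    \<comment> \<open>\<open>?k\<close> is the negative of \<open>j - i\<close> modulo
      \<open>m\<close>, so self-adjointness trades one coefficient for the other.\<close>
    have k: "l ?k ^ 2 ^ j = l (j - i) ^ 2 ^ i"
    proof -
      have "l ?k = l (j - i) ^ 2 ^ ?k" using l[of ?k] x by simp
      then have "l ?k ^ 2 ^ j = l (j - i) ^ 2 ^ (?k + j)" by (simp add: frob_frob)
      also have "?k + j = i + m" using x by simp
      finally show ?thesis by (simp add: frob_add_m)
    qed
    have "?k + j = i + m" using x by simp
    then have "(z ^ 2 ^ ?k) ^ 2 ^ j = z ^ 2 ^ i" by (metis frob_frob frob_add_m)
    with k show "?g (case x of (i, j) \<Rightarrow> (j, m - (j - i))) = ?B x"
      using x by (simp add: power_mult_distrib)
  qed auto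
  also have "sum ?g ?I + sum ?g ?J = sum ?g (?I \<union> ?J)"
    by (rule sum.union_disjoint[symmetric])
       (auto intro: finite_subset[of _ "{..<m} \<times> {..<m}"])
  also have "?I \<union> ?J = {..<m} \<times> {1..<m}" by auto
  also have "sum ?g \<dots> = (\<Sum>i<m. \<Sum>k=1..<m. (c * (l k * z ^ 2 ^ k)) ^ 2 ^ i)"
    by (rule sum.cartesian_product[symmetric])
  also have "\<dots> = trace2 m (c * (\<Sum>k=1..<m. l k * z ^ 2 ^ k))"
    by (simp add: trace2_def frob_sum sum_distrib_left)
  finally show ?thesis .
qed

text \<open>Squaring moves the summand at (i, j) to (i + 1, j + 1); for j = m - 1 it wraps to (0, i
  + 1), where self-adjointness supplies the matching coefficient. The values thus lie in the field
  with two elements.\<close>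

lemma trace_quadratic_idem:
  fixes l :: "nat \<Rightarrow> 'a"
  assumes l: "\<And>i. 1 \<le> i \<Longrightarrow> i < m \<Longrightarrow> l i = l (m - i) ^ 2 ^ i"
  shows "(trace_quadratic l c)\<^sup>2 = trace_quadratic l c"
proof -
  let ?P = "{(i, j). i < j \<and> j < m}"
  let ?e = "\<lambda>(i, j). l (j - i) ^ 2 ^ i * c ^ (2 ^ i + 2 ^ j)"
  have "(trace_quadratic l c)\<^sup>2 = (\<Sum>x\<in>?P. (?e x)\<^sup>2)"
    unfolding trace_quadratic_def square_sum by simp
  also have "\<dots> = sum ?e ?P"
  proof (rule sum.reindex_bij_witness[of _
        "\<lambda>(i, j). if i = 0 then (j - 1, m - 1) else (i - 1, j - 1)"
        "\<lambda>(i, j). if j = m - 1 then (0, i + 1) else (i + 1, j + 1)"])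
    fix x assume "x \<in> ?P"
    then obtain i j where x: "x = (i, j)" "i < j" "j < m" by auto
    have e2: "(?e x)\<^sup>2 = l (j - i) ^ 2 ^ Suc i * (c ^ 2 ^ Suc i * c ^ 2 ^ Suc j)"
      unfolding x by (simp only: case_prod_conv power_mult_distrib power_add square_frob)
    show "?e (case x of (i, j) \<Rightarrow> if j = m - 1 then (0, i + 1) else (i + 1, j + 1)) = (?e x)\<^sup>2"
    proof (cases "j = m - 1")
      case True
      then have "l (Suc i) = l (j - i) ^ 2 ^ Suc i" "c ^ 2 ^ Suc j = c"
        using l[of "Suc i"] x frob_m[of c] by simp_all
      then show ?thesis using x True unfolding e2 by (simp add: power_add mult_ac)
    next
      case False
      then show ?thesis using x unfolding e2 by (simp add: power_add)
    qed
  qed (auto split: if_splits)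
  finally show ?thesis by (simp add: trace_quadratic_def)
qed

end

section \<open>The functional equation\<close>

context binary_field
begin

text \<open>The weights W j = \<open>\<omega> powi (- (2 ^ j) + 1)\<close> satisfy W (j + 1) = (W
  j)^2 / \<omega>, so a recurrence step carries each summand to the next. The sum stops at
  \<open>i\<close> because the summand j = i + 1 would contain \<open>f 0\<close>.\<close>

lemma twisted_recurrence_solution:
  fixes s f :: "nat \<Rightarrow> 'a" and \<omega> :: 'a
  assumes rec: "\<And>i. i < n \<Longrightarrow> s (Suc i) = ((f i)\<^sup>2 + (s i)\<^sup>2) / \<omega>"
    and "f 0 = 0" and \<omega>: "\<omega> \<noteq> 0" and "i < n"
  shows "s (Suc i) = (\<Sum>j = 1..i. \<omega> powi (- (2 ^ j) + 1) * f (Suc i - j) ^ 2 ^ j)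
    + \<omega> powi (- (2 ^ Suc i) + 1) * s 0 ^ 2 ^ Suc i"
  using \<open>i < n\<close>
proof (induction i)
  case 0
  then show ?case using rec[of 0] \<open>f 0 = 0\<close> by (simp add: power_int_minus divide_inverse
      mult.commute)
next
  case (Suc i)
  define W where "W j = \<omega> powi (- (2 ^ j) + 1)" for j :: nat
  have W: "W (Suc j) = (W j)\<^sup>2 / \<omega>" for j
  proof -
    have "W (Suc j) * \<omega> = \<omega> powi (- (2 ^ Suc j) + 1 + 1)"
      unfolding W_def using \<omega> by (subst power_int_add) auto
    also have "\<dots> = (W j)\<^sup>2"
      unfolding W_def power2_eq_square using \<omega>
      by (subst power_int_add[symmetric]) auto
    finally show ?thesis using \<omega> by (metis nonzero_mult_div_cancel_right)
  qed
  have sq: "(W j * x ^ 2 ^ j)\<^sup>2 / \<omega> = W (Suc j) * x ^ 2 ^ Suc j" for j and x :: 'a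
    by (simp only: power_mult_distrib square_frob W times_divide_eq_left)
  have W1: "W (Suc 0) = 1 / \<omega>" using W[of 0] by (simp add: W_def)
  have IH: "s (Suc i) = (\<Sum>j = 1..i. W j * f (Suc i - j) ^ 2 ^ j) + W (Suc i) * s 0 ^ 2 ^ Suc i"
    using Suc by (simp add: W_def)
  have "s (Suc (Suc i)) = (f (Suc i))\<^sup>2 / \<omega> + (s (Suc i))\<^sup>2 / \<omega>"
    using rec[of "Suc i"] Suc.prems by (simp add: add_divide_distrib)
  also have "(s (Suc i))\<^sup>2 / \<omega> = (\<Sum>j = 1..i. W (Suc j) * f (Suc i - j) ^ 2 ^ Suc j)
      + W (Suc (Suc i)) * s 0 ^ 2 ^ Suc (Suc i)"
    unfolding IH square_add square_sum add_divide_distrib sum_divide_distrib sq ..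
  also have "(f (Suc i))\<^sup>2 / \<omega> = W (Suc 0) * f (Suc (Suc i) - Suc 0) ^ 2 ^ Suc 0"
    using W1 by simp
  also have "(\<Sum>j = 1..i. W (Suc j) * f (Suc i - j) ^ 2 ^ Suc j)
      = (\<Sum>j = Suc 1..Suc i. W j * f (Suc (Suc i) - j) ^ 2 ^ j)"
    by (simp only: sum.shift_bounds_cl_Suc_ivl diff_Suc_Suc)
  finally have "s (Suc (Suc i)) = (W 1 * f (Suc (Suc i) - 1) ^ 2 ^ 1
      + (\<Sum>j = Suc 1..Suc i. W j * f (Suc (Suc i) - j) ^ 2 ^ j))
      + W (Suc (Suc i)) * s 0 ^ 2 ^ Suc (Suc i)"
    by (simp only: add.assoc One_nat_def)
  also have "W 1 * f (Suc (Suc i) - 1) ^ 2 ^ 1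
      + (\<Sum>j = Suc 1..Suc i. W j * f (Suc (Suc i) - j) ^ 2 ^ j)
      = (\<Sum>j = 1..Suc i. W j * f (Suc (Suc i) - j) ^ 2 ^ j)"
    by (rule sum.atLeast_Suc_atMost[symmetric]) simp
  finally show ?case unfolding W_def .
qed

text \<open>With index \<open>m\<close> identified with 0, \<open>last\<close> is one more
  recurrence step, which must return to \<open>s 0\<close>. The m-th Frobenius power fixes \<omega>
  and \<open>s 0\<close>, so the term in \<open>s 0\<close> reproduces itself and the remaining sum
  must vanish.\<close>

lemma constructionE_paramsI:
  fixes s f :: "nat \<Rightarrow> 'a"
  assumes m: "m > 1" and nz: "\<omega> \<noteq> 0" "\<mu> \<noteq> 0" and f0: "f 0 = 0"
    and adj: "\<And>i. 1 \<le> i \<Longrightarrow> i < m \<Longrightarrow> \<mu> * f i = (\<mu> * f (m - i)) ^ 2 ^ i"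
    and rec: "\<And>i. Suc i < m \<Longrightarrow> (f i)\<^sup>2 + (s i)\<^sup>2 = \<omega> * s (Suc i)"
    and last: "(f (m - 1))\<^sup>2 + (s (m - 1))\<^sup>2 = \<omega> * s 0"
  shows "constructionE_params m \<omega> \<mu> f s"
proof -
  define s' where "s' i = (if i = m then s 0 else s i)" for i
  have rec': "s' (Suc i) = ((f i)\<^sup>2 + (s' i)\<^sup>2) / \<omega>" if "i < m" for i
  proof (cases "Suc i = m")
    case True
    then show ?thesis using last nz by (auto simp: s'_def)
  next
    case False
    then show ?thesis using that rec[of i] nz by (auto simp: s'_def)
  qed
  have sol: "s' (Suc i) = (\<Sum>j = 1..i. \<omega> powi (- (2 ^ j) + 1) * f (Suc i - j) ^ 2 ^ j)
      + \<omega> powi (- (2 ^ Suc i) + 1) * s' 0 ^ 2 ^ Suc i" if "i < m" for i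
    using twisted_recurrence_solution[of m s' f \<omega> i] rec' f0 nz(1) that by blast
  have s'0: "s' 0 = s 0" using m by (simp add: s'_def)
  have 1: "s (i + 1) = (\<Sum>j = 1..i. \<omega> powi (- (2 ^ j) + 1) * f (i + 1 - j) ^ (2 ^ j))
      + \<omega> powi (- (2 ^ (i + 1)) + 1) * s 0 ^ (2 ^ (i + 1))" if "i \<in> {0..m - 2}" for i
  proof -
    have "Suc i < m" using that m by auto
    then show ?thesis
      using sol[of i] s'0 unfolding Suc_eq_plus1 by (simp add: s'_def)
  qed
  have "\<omega> powi (- (2 ^ m) + 1) = 1"
  proof -
    have "\<omega> powi (- (2 ^ m) + 1) = \<omega> powi (- int (2 ^ m)) * \<omega>"
      using nz by (subst power_int_add) auto
    also have "\<dots> = inverse (\<omega> ^ 2 ^ m) * \<omega>"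
      by (simp only: power_int_minus power_int_of_nat)
    finally show ?thesis using frob_m[of \<omega>] nz by simp
  qed
  then have "0 + s 0 = (\<Sum>j = 1..m - 1. \<omega> powi (- (2 ^ j) + 1) * f (m - j) ^ 2 ^ j) + s 0"
    using sol[of "m - 1"] s'0 m frob_m[of "s 0"] by (simp add: s'_def)
  then have 2: "(\<Sum>j = 1..m - 1. \<omega> powi (- (2 ^ j) + 1) * f (m - j) ^ 2 ^ j) = 0"
    by (rule add_right_imp_eq[symmetric])
  show ?thesis
    unfolding constructionE_params_def
  proof (intro conjI ballI)
    show "\<mu> * f i = (\<mu> * f (m - i)) ^ 2 ^ i" if "i \<in> {1..m - 1}" for i
      using adj[of i] that m by (metis One_nat_def Suc_pred' atLeastAtMost_iff less_Suc_eq_le m_pos)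
  qed (fact nz f0 1 2)+
qed

lemma constructionE_T_eq:
  fixes s f :: "nat \<Rightarrow> 'a"
  shows "constructionE_T m \<omega> \<mu> f s a b c = \<omega> * trace2 m (\<mu>\<^sup>2 * \<omega> * (a + b * c) + \<mu> * b)
     + (\<Sum>i<m. s i * c ^ (2 ^ i)) + \<omega> * trace_quadratic (\<lambda>i. \<mu> * f i) c"
proof -
  have "{(i, j). i < j \<and> j \<le> m - 1} = {(i, j). i < j \<and> j < m}" by auto
  then show ?thesis
    by (simp add: constructionE_T_def trace_quadratic_def power_mult_distrib)
qed

text \<open>The trace is invariant under squaring, so its argument can be replaced by
  \<open>c * \<Lambda> z\<close> for a square root \<Lambda>; symmetry in c and z makes \<Lambda>
  self-adjoint and hence additive. The \<open>f i\<close> are the coefficients of \<Lambda> divided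
  by \<mu>, the \<open>s i\<close> those of the additive remainder of \<open>S\<close>.\<close>

lemma quadratic_part:
  fixes S :: "'a \<Rightarrow> 'a"
  assumes m: "m > 1" and nz: "\<omega> \<noteq> 0" "\<mu> \<noteq> 0" and S0: "S 0 = 0"
    and S: "\<And>c z. S (c + z) = S c + S z + \<omega> * trace2 m (\<mu>\<^sup>2 * \<omega> * (c * c * S z) + \<mu> * (c * S z))"
  obtains f s where "constructionE_params m \<omega> \<mu> f s"
    "\<And>c. S c = (\<Sum>i<m. s i * c ^ 2 ^ i) + \<omega> * trace_quadratic (\<lambda>i. \<mu> * f i) c"
proof -
  \<comment> \<open>The exponent \<open>2 ^ (m - 1)\<close> extracts a square root in characteristic
    two.\<close>
  define \<Lambda> where "\<Lambda> z = \<mu> * (\<omega> * S z + (S z)\<^sup>2) ^ 2 ^ (m - 1)" for z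
  have \<Lambda>2: "(\<Lambda> z)\<^sup>2 = \<mu>\<^sup>2 * (\<omega> * S z + (S z)\<^sup>2)" for z
    by (simp only: \<Lambda>_def power_mult_distrib square_root)
  have polar: "S (c + z) = S c + S z + \<omega> * trace2 m (c * \<Lambda> z)" for c z
  proof -
    have "trace2 m (c * \<Lambda> z) = trace2 m ((c * \<Lambda> z)\<^sup>2)" by (simp only: trace_square)
    also have "(c * \<Lambda> z)\<^sup>2 = \<mu>\<^sup>2 * \<omega> * (c * c * S z) + (\<mu> * (c * S z))\<^sup>2"
      by (simp only: power_mult_distrib \<Lambda>2) (simp add: power2_eq_square algebra_simps)
    finally show ?thesis unfolding S[of c z] by (simp only: trace_add trace_square)
  qed
  have sym: "trace2 m (c * \<Lambda> z) = trace2 m (z * \<Lambda> c)" for c z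
  proof -
    have "S c + S z + \<omega> * trace2 m (c * \<Lambda> z) = S c + S z + \<omega> * trace2 m (z * \<Lambda> c)"
      using polar[of c z] polar[of z c] by (simp add: add.commute)
    then show ?thesis using nz by simp
  qed
  \<comment> \<open>Self-adjointness moves \<open>z + y\<close> to the side where the trace is
    visibly additive.\<close>
  have "\<Lambda> (z + y) = \<Lambda> z + \<Lambda> y" for z y
  proof (rule trace_nondegenerate)
    fix c
    have "trace2 m (c * \<Lambda> (z + y)) = trace2 m (z * \<Lambda> c + y * \<Lambda> c)"
      unfolding sym[of c] by (simp add: distrib_right)
    also have "\<dots> = trace2 m (c * (\<Lambda> z + \<Lambda> y))"
      unfolding distrib_left trace_add sym[of c z] sym[of c y] ..
    finally show "trace2 m (c * \<Lambda> (z + y)) = trace2 m (c * (\<Lambda> z + \<Lambda> y))" .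
  qed
  then obtain l where l: "\<And>z. \<Lambda> z = (\<Sum>i<m. l i * z ^ 2 ^ i)"
    using additive_linearized[of \<Lambda>] by blast
  have adj: "l i = l (m - i) ^ 2 ^ i" if "1 \<le> i" "i < m" for i
    using self_adjoint_coeffs[of l, OF _ that] sym unfolding l .
  have split: "\<Lambda> z = l 0 * z + (\<Sum>k=1..<m. l k * z ^ 2 ^ k)" for z
  proof -
    have "{..<m} = insert 0 {1..<m}" using m by auto
    then show ?thesis unfolding l by simp
  qed
  have q: "trace_quadratic l (c + z) = trace_quadratic l c + trace_quadratic l z + trace2 m (c * (\<Lambda>
      z + l 0 * z))" for c z
  proof -
    have "\<Lambda> z + l 0 * z = (\<Sum>k=1..<m. l k * z ^ 2 ^ k)"
      unfolding split by (simp add: add_ac)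
    then show ?thesis using trace_quadratic_polar[OF adj] by simp
  qed
  have q0: "trace_quadratic l 0 = 0" unfolding trace_quadratic_def by (intro sum.neutral) (auto
      simp: power_0_left)
  \<comment> \<open>Since \<open>d + d = 0\<close> and \<open>S 0 = 0\<close>, the trace of
    \<open>d * \<Lambda> d\<close> vanishes. The same argument for \<open>trace_quadratic\<close>
    leaves the trace of \<open>l 0 * d * d\<close>, and every element is a square.\<close>
  have l0: "l 0 = 0"
  proof (rule trace_nondegenerate)
    fix c :: 'a
    define d where "d = c ^ 2 ^ (m - 1)"
    have d: "d * d = c" using square_root[of c] by (simp add: d_def power2_eq_square)
    have "\<omega> * trace2 m (d * \<Lambda> d) = 0"
      using polar[of d d] by (simp add: S0)
    then have "trace2 m (d * \<Lambda> d) = 0" using nz by simp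
    moreover have "trace2 m (d * (\<Lambda> d + l 0 * d)) = 0"
      using q[of d d] by (simp add: q0)
    moreover have "d * (\<Lambda> d + l 0 * d) = d * \<Lambda> d + c * l 0"
      using d by (simp add: algebra_simps)
    ultimately show "trace2 m (c * l 0) = trace2 m (c * 0)"
      by (simp add: trace_add) (simp add: trace2_def power_0_left)
  qed
  \<comment> \<open>Both summands have the same polarization, and in characteristic two their sum is
    their difference.\<close>
  define S1 where "S1 c = S c + \<omega> * trace_quadratic l c" for c
  have "S1 (c + z) = S1 c + S1 z" for c z
    unfolding S1_def polar[of c z] q l0 by (simp add: algebra_simps)
  then obtain s where s: "\<And>z. S1 z = (\<Sum>i<m. s i * z ^ 2 ^ i)"
    using additive_linearized[of S1] by blast
  have SS1: "S c = S1 c + \<omega> * trace_quadratic l c" for c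
    unfolding S1_def by (simp add: add_ac)
  define f where "f i = l i / \<mu>" for i
  have \<mu>f: "\<mu> * f i = l i" for i unfolding f_def using nz by simp
  have \<Lambda>f: "\<Lambda> z = \<mu> * (\<Sum>i<m. f i * z ^ 2 ^ i)" for z
    unfolding l by (simp only: sum_distrib_left mult.assoc[symmetric] \<mu>f)
  \<comment> \<open>Predecessor modulo \<open>m\<close>. In the coefficient form of
    \<open>\<Lambda>2\<close> the quadratic part cancels because it is idempotent, which leaves a
    cyclic recurrence linking \<open>f\<close> and \<open>s\<close>.\<close>
  let ?pr = "\<lambda>i. if i = 0 then m - 1 else i - 1"
  have "(\<Sum>i<m. ((f (?pr i))\<^sup>2 + (s (?pr i))\<^sup>2) * z ^ 2 ^ i) = (\<Sum>i<m. (\<omega> * s i) * z ^ 2 ^ i)" for z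
  proof -
    have "\<mu>\<^sup>2 * (\<Sum>i<m. f i * z ^ 2 ^ i)\<^sup>2 = \<mu>\<^sup>2 * (\<omega> * S z + (S z)\<^sup>2)"
      using \<Lambda>2[of z] unfolding \<Lambda>f power_mult_distrib .
    then have "(\<Sum>i<m. f i * z ^ 2 ^ i)\<^sup>2 = \<omega> * S z + (S z)\<^sup>2"
      using nz by simp
    also have "\<dots> = \<omega> * S1 z + (S1 z)\<^sup>2 + (\<omega>\<^sup>2 * trace_quadratic l z + \<omega>\<^sup>2 * (trace_quadratic l
        z)\<^sup>2)"
      unfolding SS1 square_add power_mult_distrib by (simp add: power2_eq_square algebra_simps)
    also have "\<omega>\<^sup>2 * trace_quadratic l z + \<omega>\<^sup>2 * (trace_quadratic l z)\<^sup>2 = 0"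
    proof -
      have "(trace_quadratic l z)\<^sup>2 = trace_quadratic l z" by (rule trace_quadratic_idem) (rule adj)
      then show ?thesis by (simp only: double_eq_0)
    qed
    finally have "(\<Sum>i<m. f i * z ^ 2 ^ i)\<^sup>2 + (S1 z)\<^sup>2 = \<omega> * S1 z"
      by (simp add: add_ac)
    then show ?thesis
      unfolding s square_linearized distrib_right sum.distrib by (simp add: sum_distrib_left
          mult_ac)
  qed
  note rec = linearized_unique[OF this]
  have "constructionE_params m \<omega> \<mu> f s"
  proof (rule constructionE_paramsI[OF m nz])
    show "f 0 = 0" by (simp add: f_def l0)
    show "\<mu> * f i = (\<mu> * f (m - i)) ^ 2 ^ i" if "1 \<le> i" "i < m" for i
      unfolding \<mu>f using adj[OF that] .
    show "(f i)\<^sup>2 + (s i)\<^sup>2 = \<omega> * s (Suc i)" if "Suc i < m" for i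
      using rec[OF that] by simp
    show "(f (m - 1))\<^sup>2 + (s (m - 1))\<^sup>2 = \<omega> * s 0"
      using rec[OF m_pos] by simp
  qed
  moreover have "S c = (\<Sum>i<m. s i * c ^ 2 ^ i) + \<omega> * trace_quadratic (\<lambda>i. \<mu> * f i) c" for c
    using SS1[of c] unfolding \<mu>f s .
  ultimately show thesis by (rule that)
qed

text \<open>For a nonzero value u of \<open>\<alpha> x + \<beta> y\<close>, taking c = d / u in
  \<open>ab\<close> gives \<open>\<beta> d = \<alpha> (d * d / u)\<close>. Two different such u
  would make \<alpha> vanish on all squares times a fixed nonzero factor, that is,
  everywhere.\<close>

lemma binary_case:
  fixes S \<alpha> \<beta> :: "'a \<Rightarrow> 'a"
  assumes m: "m > 1" and S0: "S 0 = 0"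
    and add: "\<And>x y. \<alpha> (x + y) = \<alpha> x + \<alpha> y" "\<And>x y. \<beta> (x + y) = \<beta> x + \<beta> y"
    and ab: "\<And>c x y. \<alpha> (c * c * (\<alpha> x + \<beta> y)) = \<beta> (c * (\<alpha> x + \<beta> y))"
    and S: "\<And>c z. \<alpha> (c * c * S z) + \<beta> (c * S z) + S (c + z) = S c + S z"
    and "\<alpha> x0 \<noteq> 0"
  obtains \<omega> \<mu> f s where "constructionE_params m \<omega> \<mu> f s"
    "\<And>a b c. \<alpha> (a + b * c) + \<beta> b + S c = constructionE_T m \<omega> \<mu> f s a b c"
proof -
  define \<omega> where "\<omega> = \<alpha> x0"
  have \<omega>: "\<omega> \<noteq> 0" using assms by (simp add: \<omega>_def)
  have zero: "\<alpha> 0 = 0" "\<beta> 0 = 0" using add[of 0 0] by auto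
  have \<beta>: "\<beta> d = \<alpha> (d * d / u)" if "u = \<alpha> x + \<beta> y" "u \<noteq> 0" for u d x y
  proof -
    have "\<alpha> ((d / u) * (d / u) * u) = \<beta> ((d / u) * u)" using ab that(1) by metis
    then show ?thesis using that by simp
  qed
  have \<beta>\<omega>: "\<beta> d = \<alpha> (d * d / \<omega>)" for d
    using \<beta>[of \<omega> x0 0 d] zero \<omega> by (simp add: \<omega>_def)
  have one_value: "u = \<omega>" if u: "u = \<alpha> x + \<beta> y" "u \<noteq> 0" for u x y
  proof (rule ccontr)
    assume "u \<noteq> \<omega>"
    define e where "e = 1 / u + 1 / \<omega>"
    have "e \<noteq> 0"
      using \<open>u \<noteq> \<omega>\<close> u \<omega> unfolding e_def add_eq_0_iff_eq by auto
    \<comment> \<open>A square root of \<open>x0 / e\<close>, so that the two expressions for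
      \<open>\<beta> d\<close> differ by \<open>\<alpha> x0\<close>.\<close>
    define d where "d = (x0 / e) ^ 2 ^ (m - 1)"
    have "d * d = x0 / e" using square_root by (simp add: d_def flip: power2_eq_square)
    then have "x0 = d * d / u + d * d / \<omega>"
      using \<open>e \<noteq> 0\<close> by (metis e_def distrib_left nonzero_eq_divide_eq times_divide_eq_right
          mult.right_neutral)
    then have "\<alpha> x0 = \<alpha> (d * d / u) + \<alpha> (d * d / \<omega>)" by (simp only: add)
    also have "\<dots> = \<beta> d + \<beta> d" using \<beta>[OF u] \<beta>\<omega> by simp
    finally show False using assms by simp
  qed
  have "\<alpha> v = 0 \<or> \<alpha> v = \<omega>" for v
    using one_value[of "\<alpha> v" v 0] zero by auto
  then obtain \<kappa> where \<kappa>: "\<And>v. \<alpha> v = \<omega> * trace2 m (\<kappa> * v)"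
    using two_valued_additive[of \<alpha> \<omega>] add(1) \<omega> by blast
  have "\<kappa> \<noteq> 0"
    using \<kappa>[of x0] assms by (auto simp: trace2_def power_0_left)
  \<comment> \<open>Chosen so that \<open>\<mu>\<^sup>2 * \<omega> = \<kappa>\<close>; then
    \<open>\<beta> v\<close> is \<omega> times the trace of the square of
    \<open>\<mu> * v\<close>.\<close>
  define \<mu> where "\<mu> = (\<kappa> / \<omega>) ^ 2 ^ (m - 1)"
  have \<mu>2: "\<mu>\<^sup>2 * \<omega> = \<kappa>" unfolding \<mu>_def square_root using \<omega> by simp
  have \<mu>: "\<mu> \<noteq> 0" using \<open>\<kappa> \<noteq> 0\<close> \<mu>2 by auto
  have \<alpha>': "\<alpha> v = \<omega> * trace2 m (\<mu>\<^sup>2 * \<omega> * v)" for v unfolding \<mu>2 by (rule \<kappa>)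
  have \<beta>': "\<beta> v = \<omega> * trace2 m (\<mu> * v)" for v
  proof -
    have "\<mu>\<^sup>2 * \<omega> * (v * v / \<omega>) = (\<mu> * v)\<^sup>2" using \<omega> by (simp add: power2_eq_square)
    then show ?thesis unfolding \<beta>\<omega> \<alpha>' by (simp only: trace_square)
  qed
  have "S (c + z) = S c + S z + \<omega> * trace2 m (\<mu>\<^sup>2 * \<omega> * (c * c * S z) + \<mu> * (c * S z))" for c z
    unfolding S[of c z, symmetric] \<alpha>' \<beta>' trace_add by (simp add: algebra_simps)
  from quadratic_part[OF m \<omega> \<mu> S0 this] obtain f s where "constructionE_params m \<omega> \<mu> f s"
    and Sq: "\<And>c. S c = (\<Sum>i<m. s i * c ^ 2 ^ i) + \<omega> * trace_quadratic (\<lambda>i. \<mu> * f i) c" by blast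
  moreover have "\<alpha> (a + b * c) + \<beta> b + S c = constructionE_T m \<omega> \<mu> f s a b c" for a b c
    unfolding constructionE_T_eq \<alpha>' \<beta>' Sq trace_add by (simp add: algebra_simps)
  ultimately show thesis using that by blast
qed

end

context field_of_order
begin

text \<open>The equation is the multiplication law of the matrices
  \<open>E_mat a b c (T a b c)\<close>. Products with most parameters 0 suffice; instantiations list
  the parameters in the order a, b, z, c, y, x.\<close>

theorem T_classification:
  fixes T :: "'a \<Rightarrow> 'a \<Rightarrow> 'a \<Rightarrow> 'a"
  assumes m: "p = 2 \<Longrightarrow> m > 1"
    and T: "\<And>a b c x y z. T (a - b * z + c * (y - z * T x y z) + x) (b + c * T x y z + y) (c + z)
       = T a b c + T x y z"
  shows "(\<exists>s. T = (\<lambda>a b c. \<Sum>i<m. s i * c ^ p ^ i))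
    \<or> p = 2 \<and> (\<exists>\<omega> \<mu> f s. constructionE_params m \<omega> \<mu> f s \<and> T = constructionE_T m \<omega> \<mu> f s)"
proof -
  define \<alpha> where "\<alpha> x = T x 0 0" for x
  define \<beta> where "\<beta> y = T 0 y 0" for y
  define S where "S c = T 0 0 c" for c
  have "S 0 + S 0 = S 0 + 0" using T[of 0 0 0 0 0 0] by (simp add: S_def)
  then have S0: "S 0 = 0" by (rule add_left_imp_eq)
  have add\<alpha>: "\<alpha> (x + y) = \<alpha> x + \<alpha> y" for x y
    using T[of x 0 0 0 0 y] by (simp add: \<alpha>_def)
  have add\<beta>: "\<beta> (x + y) = \<beta> x + \<beta> y" for x y
    using T[of 0 x 0 0 y 0] by (simp add: \<beta>_def)
  have zero: "\<alpha> 0 = 0" "\<beta> 0 = 0" using add\<alpha>[of 0 0] add\<beta>[of 0 0] by (simp_all only: add_0_right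
      add_cancel_right_right)
  have T0: "T a b 0 = \<alpha> a + \<beta> b" for a b
    using T[of a 0 0 0 b 0] by (simp add: \<alpha>_def \<beta>_def)
  \<comment> \<open>The element at (a, b, c) is the product of those at (a + bc, b, 0) and (0, 0,
    c).\<close>
  have Tabc: "T a b c = \<alpha> (a + b * c) + \<beta> b + S c" for a b c
    using T[of "a + b * c" b c 0 0 0] T0 by (simp add: S_def)
  \<comment> \<open>Obtained from the product of (0, 0, c) and (x, y, 0); the doubled term
    disappears in characteristic two.\<close>
  have ab: "\<alpha> (c * y + c * y + c * c * (\<alpha> x + \<beta> y)) + \<beta> (c * (\<alpha> x + \<beta> y)) = 0" for c x y
  proof -
    let ?u = "\<alpha> x + \<beta> y"
    have "T (c * y + x) (c * ?u + y) c = S c + ?u"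
      using T[of 0 0 0 c y x] T0 by (simp add: S_def)
    then have "\<alpha> (c * y + x + (c * ?u + y) * c) + \<beta> (c * ?u + y) = \<alpha> x + \<beta> y"
      unfolding Tabc by simp
    moreover have "c * y + x + (c * ?u + y) * c = x + (c * y + c * y + c * c * ?u)"
      by (simp add: algebra_simps)
    ultimately have "\<alpha> x + \<alpha> (c * y + c * y + c * c * ?u) + (\<beta> (c * ?u) + \<beta> y) = \<alpha> x + \<beta> y"
      by (simp only: add\<alpha>[of x] add\<beta>)
    moreover have "A + B = 0" if "a + A + (B + b) = a + b" for a b A B :: 'a
    proof -
      have "a + (A + B) + b = a + b" using that by (simp only: add.assoc)
      then show ?thesis by simp
    qed
    ultimately show ?thesis by blast
  qed
  have S: "\<alpha> (c * c * S z) + \<beta> (c * S z) + S (c + z) = S c + S z" for c z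
  proof -
    have "T (c * (0 - z * S z)) (c * S z) (c + z) = S c + S z"
      using T[of 0 0 z c 0 0] by (simp add: S_def)
    moreover have "c * (0 - z * S z) + c * S z * (c + z) = c * c * S z"
      by (simp add: algebra_simps)
    ultimately show ?thesis unfolding Tabc by simp
  qed
  have additive_case: ?thesis if \<alpha>0: "\<And>x. \<alpha> x = 0"
  proof -
    have "\<beta> y = 0" for y
    proof (rule ccontr)
      assume "\<beta> y \<noteq> 0"
      \<comment> \<open>The factor \<open>v / \<beta> y\<close> makes the argument of the outer
        \<beta> arbitrary.\<close>
      then have "\<beta> v = 0" for v
        using ab[of "v / \<beta> y" y 0] by (simp add: \<alpha>0)
      then show False using \<open>\<beta> y \<noteq> 0\<close> by simp
    qed
    then have T': "T a b c = S c" for a b c unfolding Tabc by (simp add: \<alpha>0)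
    have "S (x + y) = S x + S y" for x y
      using S[of x y] \<open>\<And>y. \<beta> y = 0\<close> by (simp add: \<alpha>0)
    then obtain s where "\<And>x. S x = (\<Sum>i<m. s i * x ^ p ^ i)"
      using additive_linearized[of S] by blast
    then have "T = (\<lambda>a b c. \<Sum>i<m. s i * c ^ p ^ i)"
      using T' by (intro ext) simp
    then show ?thesis by blast
  qed
  show ?thesis
  proof (cases "\<exists>x. \<alpha> x \<noteq> 0")
    case False
    then show ?thesis using additive_case by blast
  next
    case True
    then obtain x where x: "\<alpha> x \<noteq> 0" by blast
    show ?thesis
    proof (cases "p = 2")
      case True
      interpret binary_field "TYPE('a)" m
        by unfold_locales (use card_field True in auto)
      have "\<alpha> (c * c * (\<alpha> x + \<beta> y)) = \<beta> (c * (\<alpha> x + \<beta> y))" for c x y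
        using ab[of c y x] by (simp add: add_eq_0_iff_eq)
      then obtain \<omega> \<mu> f s where "constructionE_params m \<omega> \<mu> f s"
        "\<And>a b c. \<alpha> (a + b * c) + \<beta> b + S c = constructionE_T m \<omega> \<mu> f s a b c"
        using binary_case[of S \<alpha> \<beta> x] m S0 add\<alpha> add\<beta> S x True by metis
      then have "T = constructionE_T m \<omega> \<mu> f s"
        using Tabc by (intro ext) simp
      then show ?thesis using \<open>constructionE_params m \<omega> \<mu> f s\<close> True by blast
    next
      case False
      have two: "(2 :: 'a) \<noteq> 0"
      proof
        assume "(2 :: 'a) = 0"
        then have "CHAR('a) dvd 2" by (metis of_nat_eq_0_iff_char_dvd of_nat_numeral)
        then show False
          using False CHAR_field prime_p by (metis primes_dvd_imp_eq two_is_prime_nat)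
      qed
      have neg\<beta>: "\<beta> (- v) = - \<beta> v" for v
        using add\<beta>[of v "- v"] zero by (simp add: eq_neg_iff_add_eq_0 add.commute)
      have eq: "\<alpha> (c * c * \<alpha> x) + \<beta> (c * \<alpha> x) = 0" for c
        using ab[of c 0 x] zero by simp
      have \<alpha>c: "\<alpha> (c * c * \<alpha> x) = 0" for c
      proof -
        have "\<alpha> (c * c * \<alpha> x) - \<beta> (c * \<alpha> x) = 0"
          using eq[of "- c"] neg\<beta>[of "c * \<alpha> x"] by simp
        then have "\<alpha> (c * c * \<alpha> x) + \<alpha> (c * c * \<alpha> x) = 0"
          using eq[of c] by (simp add: algebra_simps)
        then have "2 * \<alpha> (c * c * \<alpha> x) = 0" by simp
        then show ?thesis using two by simp
      qed
      have "\<alpha> v = 0" for v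
      proof -
        \<comment> \<open>Polarization by (c + 1)^2 = c^2 + 2c + 1: as 2 is invertible, the middle
          term times \<open>\<alpha> x\<close> can be any \<open>v\<close>.\<close>
        define c where "c = v / (2 * \<alpha> x)"
        have v: "2 * c * \<alpha> x = v" using x two by (simp add: c_def)
        have "(c + 1) * (c + 1) * \<alpha> x = c * c * \<alpha> x + (2 * c * \<alpha> x + 1 * 1 * \<alpha> x)"
          by (simp add: algebra_simps)
        then have "\<alpha> ((c + 1) * (c + 1) * \<alpha> x)
            = \<alpha> (c * c * \<alpha> x) + (\<alpha> (2 * c * \<alpha> x) + \<alpha> (1 * 1 * \<alpha> x))"
          by (simp only: add\<alpha>)
        then show ?thesis unfolding \<alpha>c v by simp
      qed
      then show ?thesis using x by blast
    qed
  qed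
qed

end

section \<open>Collineations of the Payne derived quadrangle\<close>

lemma vec4_eq_iff: "x = y \<longleftrightarrow> x $ 1 = y $ 1 \<and> x $ 2 = y $ 2 \<and> x $ 3 = y $ 3 \<and> x $ 4 = (y :: 'b ^ 4) $
    4"
  by (simp add: vec_eq_iff forall_4)

lemma vector_matrix_nth: "(x v* A) $ j = x $ 1 * A $ 1 $ j + x $ 2 * A $ 2 $ j + x $ 3 * A $ 3 $ j +
    x $ 4 * A $ 4 $ j"
  for A :: "'a::field ^ 4 ^ 4"
  by (simp add: vector_matrix_mult_def sum_4 mult.commute)

lemma vector_matrix_add: "(x + y) v* A = x v* A + y v* (A :: 'a::field ^ 4 ^ 4)"
  by (simp add: vec4_eq_iff vector_matrix_nth algebra_simps)

lemma vector_matrix_diff: "(x - y) v* A = x v* A - y v* (A :: 'a::field ^ 4 ^ 4)"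
  by (simp add: vec4_eq_iff vector_matrix_nth algebra_simps)

lemma vector_matrix_scale: "(k *s x) v* A = k *s (x v* (A :: 'a::field ^ 4 ^ 4))"
  by (simp add: vec4_eq_iff vector_matrix_nth algebra_simps)

lemma matrix_matrix_nth: "(A ** B) $ i $ j = A $ i $ 1 * B $ 1 $ j + A $ i $ 2 * B $ 2 $ j + A $ i $
    3 * B $ 3 $ j + A $ i $ 4 * B $ 4 $ j"
  for A :: "'a::field ^ 4 ^ 4"
  by (simp add: matrix_matrix_mult_def sum_4)

lemma vector_matrix_matrix: "x v* (A ** B) = (x v* A) v* (B :: 'a::field ^ 4 ^ 4)"
  by (rule vector_matrix_mul_assoc[symmetric])

lemma zero_vector_matrix: "0 v* A = (0 :: 'a::field ^ 4)"
  by (simp add: vec4_eq_iff vector_matrix_nth)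

lemma vector_matrix_one: "x v* (mat 1 :: 'a::field ^ 4 ^ 4) = x"
  by (simp add: vec4_eq_iff vector_matrix_nth mat_def)

lemma span_singleton_eq: "vec.span {x} = {k *s x | k. True}" for x :: "'a::field ^ 4"
  by (auto simp: vec.span_singleton)

lemma span_vector_matrix: "(\<lambda>y. y v* A) ` vec.span {x} = vec.span {x v* (A :: 'a::field ^ 4 ^ 4)}"
  unfolding span_singleton_eq by (auto simp: vector_matrix_scale image_def)

lemma span_eq_scale: "k \<noteq> 0 \<Longrightarrow> vec.span {k *s x} = vec.span {x :: 'a::field ^ 4}"
  unfolding span_singleton_eq
  by (auto simp: vec.scale_scale) (metis nonzero_eq_divide_eq)

lemma span_affine_eq:
  assumes "vec.span {x} = vec.span {y :: 'a::field ^ 4}" "x $ 4 = y $ 4" "x $ 4 \<noteq> 0"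
  shows "x = y"
proof -
  have "x \<in> vec.span {y}" using assms(1) by (metis insertI1 vec.span_base)
  then obtain k where "x = k *s y" by (auto simp: span_singleton_eq)
  with assms show ?thesis by simp
qed

lemma pg_points_eq: "pg_points = {vec.span {x} | x. x \<noteq> (0 :: 'a::field ^ 4)}"
proof
  show "pg_points \<subseteq> {vec.span {x} | x. x \<noteq> (0 :: 'a ^ 4)}"
  proof
    fix Q :: "('a ^ 4) set"
    assume "Q \<in> pg_points"
    then have sub: "vec.subspace Q" and dim: "vec.dim Q = 1" by (auto simp: pg_points_def)
    obtain x where x: "x \<in> Q" "x \<noteq> 0"
      using dim by (metis vec.dim_eq_0 subsetI singletonI zero_neq_one singleton_iff)
    then have "Q \<subseteq> vec.span {x}"
      using dim by (intro vec.card_ge_dim_independent) auto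
    moreover have "vec.span {x} \<subseteq> Q"
      using x sub by (intro vec.span_minimal) auto
    ultimately show "Q \<in> {vec.span {x} | x. x \<noteq> 0}" using x by blast
  qed
qed (auto simp: pg_points_def vec.dim_eq_card_independent)

lemma span_in_pg_points: "x \<noteq> 0 \<Longrightarrow> vec.span {x :: 'a::field ^ 4} \<in> pg_points"
  by (auto simp: pg_points_eq)

lemma affine_span_payne:
  assumes "u $ 4 = (1 :: 'a::field)"
  shows "vec.span {u} \<in> payne_points"
proof -
  have "u \<in> vec.span {u}" by (simp add: vec.span_base)
  moreover have "u \<noteq> 0" using assms by auto
  ultimately show ?thesis
    using assms by (auto simp: payne_points_def perp_base_point span_in_pg_points)
qed

section \<open>Collineations induced by matrices\<close>

lemma collineation_span:
  "x \<noteq> 0 \<Longrightarrow> collineation A id (vec.span {x}) = vec.span {x v* (A :: 'a::field ^ 4 ^ 4)}"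
  by (simp add: collineation_def span_in_pg_points semilinear_def span_vector_matrix)

lemma collineation_eqI:
  assumes "\<And>x. x \<noteq> 0 \<Longrightarrow> vec.span {x v* A} = vec.span {x v* (B :: 'a::field ^ 4 ^ 4)}"
  shows "collineation A id = collineation B id"
proof
  fix Q
  show "collineation A id Q = collineation B id Q"
  proof (cases "Q \<in> pg_points")
    case True
    then obtain x where "Q = vec.span {x}" "x \<noteq> 0" by (auto simp: pg_points_eq)
    then show ?thesis using assms by (simp add: collineation_span)
  qed (simp add: collineation_def)
qed

text \<open>On vectors with fourth coordinate 1 the normalization removes the scalar ambiguity of
  projective points, and these vectors span the space.\<close>

lemma collineation_normalized_inj:
  fixes A B :: "'a::field ^ 4 ^ 4"
  assumes eq: "collineation A id = collineation B id"
    and "\<And>x. (x v* A) $ 4 = x $ 4" "\<And>x. (x v* B) $ 4 = x $ 4"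
  shows "A = B"
proof -
  have aff: "x v* A = x v* B" if "x $ 4 = 1" for x
  proof (rule span_affine_eq)
    have "x \<noteq> 0" using that by auto
    then show "vec.span {x v* A} = vec.span {x v* B}" using eq collineation_span by metis
  qed (use assms that in auto)
  have "x v* A = x v* B" for x
  proof -
    have "(x + (1 - x $ 4) *s vector [0, 0, 0, 1]) v* A = (x + (1 - x $ 4) *s vector [0, 0, 0, 1])
        v* B"
      and e: "vector [0, 0, 0, 1] v* A = vector [0, 0, 0, 1] v* B"
      by (rule aff; simp)+
    then show ?thesis unfolding vector_matrix_add vector_matrix_scale e using add_right_imp_eq by
        blast
  qed
  then have "(vector [1,0,0,0] v* A) $ j = (vector [1,0,0,0] v* B) $ j"
    "(vector [0,1,0,0] v* A) $ j = (vector [0,1,0,0] v* B) $ j"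
    "(vector [0,0,1,0] v* A) $ j = (vector [0,0,1,0] v* B) $ j"
    "(vector [0,0,0,1] v* A) $ j = (vector [0,0,0,1] v* B) $ j" for j by simp_all
  then have "A $ 1 $ j = B $ 1 $ j" "A $ 2 $ j = B $ 2 $ j" "A $ 3 $ j = B $ 3 $ j" "A $ 4 $ j = B $
      4 $ j" for j
    by (simp_all add: vector_matrix_nth)
  then show ?thesis by (simp add: vec_eq_iff forall_4)
qed

lemma collineation_in_Bij:
  fixes A A' :: "'a::field ^ 4 ^ 4"
  assumes "A ** A' = mat 1" "A' ** A = mat 1"
  shows "collineation A id \<in> Bij pg_points"
proof -
  have nz: "x v* D \<noteq> 0" if "D ** D' = mat 1" "x \<noteq> 0" for D D' :: "'a ^ 4 ^ 4" and x
    using that by (metis zero_vector_matrix vector_matrix_one vector_matrix_matrix)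
  have into: "collineation D id Q \<in> pg_points"
    and inverse: "collineation D' id (collineation D id Q) = Q"
    if "D ** D' = mat 1" "Q \<in> pg_points" for D D' :: "'a ^ 4 ^ 4" and Q
  proof -
    obtain x where x: "Q = vec.span {x}" "x \<noteq> 0" using \<open>Q \<in> pg_points\<close> by (auto simp: pg_points_eq)
    then show "collineation D id Q \<in> pg_points"
      using nz[OF that(1)] by (simp add: collineation_span span_in_pg_points)
    have "(x v* D) v* D' = x" using that(1) vector_matrix_one vector_matrix_matrix by metis
    then show "collineation D' id (collineation D id Q) = Q"
      using x nz[OF that(1)] by (simp only: collineation_span not_False_eq_True)
  qed
  have "bij_betw (collineation A id) pg_points pg_points"
    by (rule bij_betw_byWitness[where f' = "collineation A' id"])
       (use assms into inverse in blast)+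
  then show ?thesis by (simp add: Bij_def collineation_def)
qed

text \<open>Matrices act on row vectors from the right while permutations compose from right to
  left; hence the reversed factors.\<close>

lemma collineation_mult:
  fixes A B :: "'a::field ^ 4 ^ 4"
  assumes "collineation A id \<in> Bij pg_points" "collineation B id \<in> Bij pg_points"
  shows "collineation A id \<otimes>\<^bsub>BijGroup pg_points\<^esub> collineation B id = collineation (B ** A) id"
proof
  fix Q
  have "compose pg_points (collineation A id) (collineation B id) Q = collineation (B ** A) id Q"
  proof (cases "Q \<in> pg_points")
    case True
    then obtain x where Q: "Q = vec.span {x}" "x \<noteq> 0" by (auto simp: pg_points_eq)
    have "collineation B id Q \<in> pg_points"
      using True assms(2) Bij_imp_funcset by blast
    then have "vec.span {x v* B} \<in> pg_points" using Q by (simp add: collineation_span)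
    then have "x v* B \<noteq> 0" by (auto simp: pg_points_def)
    then show ?thesis using True Q by (simp add: compose_def collineation_span vector_matrix_matrix)
  qed (simp add: compose_def collineation_def)
  then show "(collineation A id \<otimes>\<^bsub>BijGroup pg_points\<^esub> collineation B id) Q = collineation (B ** A)
      id Q"
    using assms by (simp add: BijGroup_def)
qed

lemma collineation_mat_1: "collineation (mat 1 :: 'a::field ^ 4 ^ 4) id = \<one>\<^bsub>BijGroup pg_points\<^esub>"
  by (simp add: BijGroup_def collineation_def semilinear_def vector_matrix_one)

text \<open>For vectors with fourth coordinate 1, the alternatives are a common totally isotropic
  line and a common line through the base point.\<close>

definition payne_collinear :: "'a::field ^ 4 \<Rightarrow> 'a ^ 4 \<Rightarrow> bool" where
  "payne_collinear u v \<longleftrightarrow> sympl_form u v = 0 \<or> (u $ 2 = v $ 2 \<and> u $ 3 = v $ 3)"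

lemma payne_line_through:
  fixes u v :: "'a::field ^ 4"
  assumes u: "u $ 4 = 1" "v $ 4 = 1" "u \<noteq> v" "payne_collinear u v"
  obtains L where "L \<in> payne_lines" "vec.span {u} \<subseteq> L" "vec.span {v} \<subseteq> L"
proof (cases "sympl_form u v = 0")
  case True
  let ?L = "vec.span {u, v}"
  have comb: "\<exists>k l. x = k *s u + l *s v" if "x \<in> ?L" for x
    using that unfolding vec.span_insert[of u "{v}"] span_singleton_eq by (auto simp: algebra_simps)
  have "u \<notin> vec.span {v}" using u by (auto simp: span_singleton_eq)
  moreover have "v \<noteq> 0" using u by auto
  ultimately have "vec.independent {u, v}" by (simp add: vec.independent_insert)
  then have "vec.dim ?L = 2" using u vec.dim_span_eq_card_independent[of "{u, v}"] by simp
  moreover have "sympl_form x y = 0" if xy: "x \<in> ?L" "y \<in> ?L" for x y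
  proof -
    obtain k l k' l' where "x = k *s u + l *s v" "y = k' *s u + l' *s v" using comb xy by metis
    then have "sympl_form x y = (k * l' - l * k') * sympl_form u v"
      by (simp add: sympl_form_def algebra_simps)
    then show ?thesis using True by simp
  qed
  moreover have "\<not> base_point \<subseteq> ?L"
  proof
    assume "base_point \<subseteq> ?L"
    then have "vector [1, 0, 0, 0] \<in> ?L"
      unfolding base_point_def by (meson insertI1 subsetD vec.span_base)
    moreover have "u \<in> ?L" by (simp add: vec.span_base)
    ultimately have "sympl_form u (vector [1, 0, 0, 0]) = 0"
      using \<open>\<And>y x. \<lbrakk>x \<in> ?L; y \<in> ?L\<rbrakk> \<Longrightarrow> sympl_form x y = 0\<close> by blast
    then show False using u by (simp add: sympl_form_def)
  qed
  ultimately have "?L \<in> payne_lines"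
    by (auto simp: payne_lines_def W_lines_def pg_lines_def)
  then show thesis by (rule that) (simp_all add: vec.span_mono)
next
  case False
  let ?L = "vec.span (base_point \<union> vec.span {u})"
  have "vec.span {u} \<in> payne_points" using u by (simp add: affine_span_payne)
  then have "?L \<in> payne_lines" by (auto simp: payne_lines_def)
  moreover have "u \<in> ?L" by (simp add: vec.span_base)
  moreover have "v \<in> ?L"
  proof -
    have "v = u + (v $ 1 - u $ 1) *s vector [1, 0, 0, 0]"
      using False u by (auto simp: vec4_eq_iff payne_collinear_def)
    moreover have "vector [1, 0, 0, 0] \<in> ?L"
      by (intro vec.span_base UnI1) (simp add: base_point_def vec.span_base)
    ultimately show ?thesis
      using \<open>u \<in> ?L\<close> by (metis vec.span_add vec.span_scale)
  qed
  ultimately show thesis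
    by (intro that[of ?L] vec.span_minimal) simp_all
qed

lemma payne_line_collinear:
  fixes u v :: "'a::field ^ 4"
  assumes "L \<in> payne_lines" "vec.span {u} \<subseteq> L" "vec.span {v} \<subseteq> L" "u $ 4 = 1" "v $ 4 = 1"
  shows "payne_collinear u v"
proof -
  have uv: "u \<in> L" "v \<in> L" using assms by (meson insertI1 subsetD vec.span_base)+
  consider "L \<in> W_lines" | Q where "L = vec.span (base_point \<union> Q)" "Q \<in> payne_points"
    using assms(1) by (auto simp: payne_lines_def)
  then show ?thesis
  proof cases
    case 1
    then show ?thesis using uv by (auto simp: W_lines_def payne_collinear_def)
  next
    case 2
    then obtain a b c where Q: "Q = vec.span {vector [a, b, c, 1]}" by (auto simp: payne_points_eq)
    have "L \<subseteq> {x. x $ 2 = b * x $ 4 \<and> x $ 3 = c * x $ 4}"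
      unfolding 2
    proof (rule vec.span_minimal)
      show "vec.subspace {x :: 'a ^ 4. x $ 2 = b * x $ 4 \<and> x $ 3 = c * x $ 4}"
        by (auto simp: vec.subspace_def algebra_simps)
    qed (auto simp: Q base_point_def span_singleton_eq)
    then have "u $ 2 = b" "u $ 3 = c" "v $ 2 = b" "v $ 3 = c"
      using uv assms(4,5) by auto
    then show ?thesis by (simp add: payne_collinear_def)
  qed
qed

text \<open>The similarities of the form that fix the base point and the hyperplane at infinity,
  normalized by their last diagonal entry; the remaining entries are forced by the middle block and the last
  row.\<close>

definition similarity_mat :: "'a::field \<Rightarrow> 'a \<Rightarrow> 'a \<Rightarrow> 'a \<Rightarrow> 'a \<Rightarrow> 'a \<Rightarrow> 'a \<Rightarrow> 'a ^ 4 ^ 4" where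
  "similarity_mat a b c w x y z = vector
     [vector [w * z - x * y, 0, 0, 0],
      vector [b * x - c * w, w, x, 0],
      vector [b * z - c * y, y, z, 0],
      vector [a, b, c, 1]]"

lemma similarity_mat_mult:
  "similarity_mat a b c w x y z ** similarity_mat a' b' c' w' x' y' z'
   = similarity_mat (a * (w' * z' - x' * y') + b * (b' * x' - c' * w') + c * (b' * z' - c' * y') +
       a')
       (b * w' + c * y' + b') (b * x' + c * z' + c')
       (w * w' + x * y') (w * x' + x * z') (y * w' + z * y') (y * x' + z * z')"
  unfolding similarity_mat_def by (simp add: vec4_eq_iff matrix_matrix_nth algebra_simps)

lemma similarity_mat_one: "similarity_mat 0 0 0 1 0 0 1 = mat 1"
  unfolding similarity_mat_def by (simp add: vec4_eq_iff mat_def)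

lemma similarity_mat_eq_E_mat: "similarity_mat a b c 1 0 t 1 = E_mat a b c t"
  unfolding similarity_mat_def E_mat_def by simp

lemma similarity_mat_nth4: "(v v* similarity_mat a b c w x y z) $ 4 = v $ 4"
  by (simp add: vector_matrix_nth similarity_mat_def)

text \<open>The isotropic directions at an affine vector form a subspace. Each is sent either to an
  isotropic direction at the image or into the base point, so one alternative holds for all of them;
  the second would squeeze two independent directions into one line. The matrix entries follow by
  evaluating orthogonality at special vectors.\<close>

lemma collinearity_preserving_similarity:
  fixes A :: "'a::field ^ 4 ^ 4"
  assumes col: "\<And>x. (x v* A) $ 4 = x $ 4"
    and inj: "\<And>x. x v* A = 0 \<Longrightarrow> x = 0" and surj: "\<And>y. \<exists>x. x v* A = y"
    and pres: "\<And>u v. u $ 4 = 1 \<Longrightarrow> v $ 4 = 1 \<Longrightarrow> u \<noteq> v \<Longrightarrow> payne_collinear u v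
      \<Longrightarrow> payne_collinear (u v* A) (v v* A)"
  shows "A = similarity_mat (A $ 4 $ 1) (A $ 4 $ 2) (A $ 4 $ 3) (A $ 2 $ 2) (A $ 2 $ 3) (A $ 3 $ 2)
      (A $ 3 $ 3)"
proof -
  have bil: "sympl_form u (x + y) = sympl_form u x + sympl_form u y" for u x y :: "'a ^ 4"
    by (simp add: sympl_form_def algebra_simps)
  have self: "sympl_form u u = 0" for u :: "'a ^ 4" by (simp add: sympl_form_def)
  have perp: "sympl_form (u v* A) (d v* A) = 0"
    if u: "u $ 4 = 1" and d: "d $ 4 = 0" "sympl_form u d = 0" for u d
  proof (rule ccontr)
    let ?\<psi> = "\<lambda>d. (d v* A) $ 2 = 0 \<and> (d v* A) $ 3 = 0"
    have alt: "sympl_form (u v* A) (d v* A) = 0 \<or> ?\<psi> d"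
      if d: "d $ 4 = 0" "sympl_form u d = 0" for d
    proof (cases "d = 0")
      case False
      have "payne_collinear u (u + d)" using d by (simp add: payne_collinear_def bil self)
      then have "payne_collinear (u v* A) ((u + d) v* A)"
        using pres[of u "u + d"] u d False by simp
      then show ?thesis by (simp add: payne_collinear_def vector_matrix_add bil self)
    qed (simp add: vector_matrix_nth)
    assume nz: "sympl_form (u v* A) (d v* A) \<noteq> 0"
    \<comment> \<open>A vector space is not the union of two proper subspaces: if \<open>d\<close>
      violates one condition and \<open>e\<close> the other, \<open>d + e\<close> violates
      both.\<close>
    have \<psi>: "?\<psi> e" if e: "e $ 4 = 0" "sympl_form u e = 0" for e
    proof (rule ccontr)
      assume "\<not> ?\<psi> e"
      then have "sympl_form (u v* A) (e v* A) = 0" using alt e by blast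
      then have "sympl_form (u v* A) ((d + e) v* A) \<noteq> 0" using nz by (simp add: vector_matrix_add
          bil)
      moreover have "(d + e) $ 4 = 0" "sympl_form u (d + e) = 0" using d e by (simp_all add: bil)
      ultimately have "?\<psi> (d + e)" using alt by blast
      moreover have "?\<psi> d" using alt d nz by blast
      ultimately show False using \<open>\<not> ?\<psi> e\<close> by (simp add: vector_matrix_add)
    qed
    \<comment> \<open>A basis of the isotropic directions at \<open>u\<close>.\<close>
    let ?d1 = "vector [- (u $ 3), 1, 0, 0] :: 'a ^ 4" and ?d2 = "vector [u $ 2, 0, 1, 0] :: 'a ^ 4"
    have \<psi>1: "?\<psi> ?d1" and \<psi>2: "?\<psi> ?d2"
      by (rule \<psi>; use u in \<open>simp add: sympl_form_def\<close>)+
    define k1 where "k1 = (?d1 v* A) $ 1"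
    define k2 where "k2 = (?d2 v* A) $ 1"
    have "(k2 *s ?d1 - k1 *s ?d2) v* A = 0"
      unfolding vector_matrix_diff vector_matrix_scale using \<psi>1 \<psi>2 col[of ?d1] col[of ?d2]
      by (simp add: vec4_eq_iff k1_def k2_def)
    then have "k2 *s ?d1 - k1 *s ?d2 = 0" by (rule inj)
    then have "k1 = 0" by (simp add: vec4_eq_iff)
    then have "?d1 v* A = 0" using \<psi>1 col[of ?d1] by (simp add: vec4_eq_iff k1_def)
    from inj[OF this] show False by (simp add: vec4_eq_iff)
  qed
  have A4: "A $ 1 $ 4 = 0" "A $ 2 $ 4 = 0" "A $ 3 $ 4 = 0" "A $ 4 $ 4 = 1"
    using col[of "vector [1,0,0,0]"] col[of "vector [0,1,0,0]"] col[of "vector [0,0,1,0]"]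
      col[of "vector [0,0,0,1]"] by (simp_all add: vector_matrix_nth)
  note ev = sympl_form_def vector_matrix_nth A4
  have S42: "A $ 2 $ 1 = A $ 4 $ 2 * A $ 2 $ 3 - A $ 4 $ 3 * A $ 2 $ 2"
    using perp[of "vector [0,0,0,1]" "vector [0,1,0,0]"] by (simp add: ev algebra_simps)
  have S43: "A $ 3 $ 1 = A $ 4 $ 2 * A $ 3 $ 3 - A $ 4 $ 3 * A $ 3 $ 2"
    using perp[of "vector [0,0,0,1]" "vector [0,0,1,0]"] by (simp add: ev algebra_simps)
  have S12: "A $ 1 $ 2 * A $ 2 $ 3 = A $ 1 $ 3 * A $ 2 $ 2"
    using perp[of "vector [1,0,0,1]" "vector [0,1,0,0]"] by (simp add: ev S42 algebra_simps)
  have S13: "A $ 1 $ 2 * A $ 3 $ 3 = A $ 1 $ 3 * A $ 3 $ 2"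
    using perp[of "vector [1,0,0,1]" "vector [0,0,1,0]"] by (simp add: ev S43 algebra_simps)
  \<comment> \<open>Here isotropy comes from two cancelling contributions, which ties the middle
    determinant to the entry \<open>A $ 1 $ 1\<close>.\<close>
  have S23: "A $ 2 $ 2 * A $ 3 $ 3 - A $ 2 $ 3 * A $ 3 $ 2
      = A $ 1 $ 1 - A $ 4 $ 2 * A $ 1 $ 3 + A $ 4 $ 3 * A $ 1 $ 2"
    using perp[of "vector [0,1,0,1]" "vector [1,0,1,0]"] S12 by (simp add: ev S43 algebra_simps)
  let ?k = "A $ 2 $ 2 * A $ 3 $ 3 - A $ 2 $ 3 * A $ 3 $ 2"
  have "?k \<noteq> 0"
  proof
    assume k0: "?k = 0"
    obtain d e where de: "d v* A = vector [0, 1, 0, 0]" "e v* A = vector [0, 0, 1, 0]"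
      using surj by metis
    have d4: "d $ 4 = 0" "e $ 4 = 0" using col[of d] col[of e] de by simp_all
    \<comment> \<open>Cauchy-Binet: the left side, which is 1, expands in minors of columns 2 and 3
      of \<open>A\<close>, all of them 0 here.\<close>
    have "(d v* A) $ 2 * (e v* A) $ 3 - (d v* A) $ 3 * (e v* A) $ 2
        = (d $ 1 * e $ 2 - d $ 2 * e $ 1) * (A $ 1 $ 2 * A $ 2 $ 3 - A $ 1 $ 3 * A $ 2 $ 2)
        + (d $ 1 * e $ 3 - d $ 3 * e $ 1) * (A $ 1 $ 2 * A $ 3 $ 3 - A $ 1 $ 3 * A $ 3 $ 2)
        + (d $ 2 * e $ 3 - d $ 3 * e $ 2) * ?k"
      by (simp add: vector_matrix_nth d4 algebra_simps)
    then show False unfolding k0 de S12 S13 by simp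
  qed
  moreover have "A $ 1 $ 2 * ?k = 0"
  proof -
    have "A $ 1 $ 2 * ?k = A $ 2 $ 2 * (A $ 1 $ 2 * A $ 3 $ 3) - A $ 3 $ 2 * (A $ 1 $ 2 * A $ 2 $
        3)"
      by (simp add: algebra_simps)
    then show ?thesis unfolding S12 S13 by (simp add: mult_ac)
  qed
  moreover have "A $ 1 $ 3 * ?k = 0"
  proof -
    have "A $ 1 $ 3 * ?k = A $ 3 $ 3 * (A $ 1 $ 3 * A $ 2 $ 2) - A $ 2 $ 3 * (A $ 1 $ 3 * A $ 3 $
        2)"
      by (simp add: algebra_simps)
    then show ?thesis unfolding S12[symmetric] S13[symmetric] by (simp add: mult_ac)
  qed
  ultimately have A1: "A $ 1 $ 2 = 0" "A $ 1 $ 3 = 0" by auto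
  then show ?thesis
    using S23 S42 S43 A4 by (simp add: vec4_eq_iff similarity_mat_def)
qed

text \<open>Affine points go to affine points, whereas a nonzero entry above the corner of the last
  column would send some affine vector to infinity. Scaling by the corner entry gives the normalized
  form.\<close>

lemma payne_automorphism_similarity:
  fixes A :: "'a::field ^ 4 ^ 4"
  assumes "invertible A" and aut: "is_payne_automorphism (collineation A id)"
  obtains a b c w x y z where "collineation A id = collineation (similarity_mat a b c w x y z) id"
proof -
  obtain A' where A': "A ** A' = mat 1" "A' ** A = mat 1"
    using assms(1) by (auto simp: invertible_def)
  have inj: "x = 0" if "x v* A = 0" for x
    using that A' by (metis zero_vector_matrix vector_matrix_one vector_matrix_matrix)
  have surj: "\<exists>x. x v* A = y" for y
    using A' by (metis vector_matrix_one vector_matrix_matrix)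
  let ?g = "collineation A id"
  obtain h where bij: "bij_betw ?g payne_points payne_points"
    and h: "bij_betw h payne_lines payne_lines"
    and inc: "\<And>Q L. Q \<in> payne_points \<Longrightarrow> L \<in> payne_lines \<Longrightarrow> Q \<subseteq> L \<longleftrightarrow> ?g Q \<subseteq> h L"
    using aut by (auto simp: is_payne_automorphism_def)
  note aff = affine_span_payne[where 'a = 'a]
  have nz: "u \<noteq> 0" if "u $ 4 = 1" for u :: "'a ^ 4" using that by auto
  have out: "(u v* A) $ 4 \<noteq> 0" if "u $ 4 = 1" for u
  proof
    assume 0: "(u v* A) $ 4 = 0"
    have "vec.span {u v* A} \<in> payne_points"
      using bij aff[OF that] nz[OF that] by (metis bij_betwE collineation_span)
    moreover have "vec.span {u v* A} \<subseteq> perp base_point"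
      using 0 by (auto simp: span_singleton_eq perp_base_point)
    ultimately show False by (auto simp: payne_points_def)
  qed
  have A4: "A $ 4 $ 4 \<noteq> 0" using out[of "vector [0,0,0,1]"] by (simp add: vector_matrix_nth)
  have A14: "A $ 1 $ 4 = 0"
    using out[of "vector [- A $ 4 $ 4 / A $ 1 $ 4, 0, 0, 1]"] by (auto simp: vector_matrix_nth
        split: if_splits)
  have A24: "A $ 2 $ 4 = 0"
    using out[of "vector [0, - A $ 4 $ 4 / A $ 2 $ 4, 0, 1]"] by (auto simp: vector_matrix_nth
        split: if_splits)
  have A34: "A $ 3 $ 4 = 0"
    using out[of "vector [0, 0, - A $ 4 $ 4 / A $ 3 $ 4, 1]"] by (auto simp: vector_matrix_nth
        split: if_splits)
  define k where "k = inverse (A $ 4 $ 4)"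
  have k: "k \<noteq> 0" "k * A $ 4 $ 4 = 1" using A4 by (simp_all add: k_def)
  define B where "B = (\<chi> i j. k * A $ i $ j)"
  have B: "x v* B = k *s (x v* A)" for x
    by (simp add: vec4_eq_iff vector_matrix_nth B_def algebra_simps)
  have coll: "?g = collineation B id"
    by (rule collineation_eqI) (simp add: B span_eq_scale k)
  have col: "(x v* B) $ 4 = x $ 4" for x
    unfolding B using k A14 A24 A34 by (simp add: vector_matrix_nth algebra_simps)
  have "B = similarity_mat (B $ 4 $ 1) (B $ 4 $ 2) (B $ 4 $ 3) (B $ 2 $ 2) (B $ 2 $ 3) (B $ 3 $ 2)
      (B $ 3 $ 3)"
  proof (rule collinearity_preserving_similarity[OF col])
    show "x = 0" if "x v* B = 0" for x using that k inj[of x] by (simp add: B)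
    show "\<exists>x. x v* B = y" for y
    proof -
      obtain x where "x v* A = y" using surj by blast
      then have "(inverse k *s x) v* B = y"
        using k by (simp add: B vector_matrix_scale)
      then show ?thesis by blast
    qed
    fix u v :: "'a ^ 4"
    assume uv: "u $ 4 = 1" "v $ 4 = 1" "u \<noteq> v" "payne_collinear u v"
    obtain L where L: "L \<in> payne_lines" "vec.span {u} \<subseteq> L" "vec.span {v} \<subseteq> L"
      using payne_line_through[OF uv] .
    have "h L \<in> payne_lines" using L h by (meson bij_betwE)
    moreover have "vec.span {u v* B} \<subseteq> h L" "vec.span {v v* B} \<subseteq> h L"
      using inc[OF aff] L uv nz unfolding coll by (simp_all add: collineation_span)
    ultimately show "payne_collinear (u v* B) (v v* B)"
      by (rule payne_line_collinear) (simp_all add: col uv)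
  qed
  then show thesis using that coll by metis
qed

section \<open>Unipotent similarities\<close>

context field_of_order
begin

text \<open>The binomial theorem for the commuting operators 1 and \<open>D\<close>, written with
  iterates.\<close>

lemma funpow_binomial:
  fixes F :: "'a ^ 4 \<Rightarrow> 'a ^ 4"
  assumes add: "\<And>x y. F (x + y) = F x + F y" and scale: "\<And>k x. F (k *s x) = k *s F x"
  defines "D \<equiv> \<lambda>x. F x - x"
  shows "(F ^^ n) x = (\<Sum>k\<le>n. of_nat (n choose k) *s (D ^^ k) x)"
proof (induction n)
  case (Suc n)
  have D0: "D 0 = 0" using scale[of 0 0] by (simp add: D_def)
  have Dadd: "D (x + y) = D x + D y" for x y by (simp add: D_def add)
  have Dsum: "D (sum g A) = (\<Sum>k\<in>A. D (g k))" for g :: "nat \<Rightarrow> 'a ^ 4" and A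
    by (induction A rule: infinite_finite_induct) (simp_all add: D0 Dadd)
  have Dscale: "D (k *s x) = k *s D x" for k x
    by (simp add: D_def scale vec.scale_right_diff_distrib)
  have "(F ^^ Suc n) x = D ((F ^^ n) x) + (F ^^ n) x" by (simp add: D_def)
  also have "\<dots> = (\<Sum>k\<le>n. of_nat (n choose k) *s (D ^^ Suc k) x) + (\<Sum>k\<le>n. of_nat (n choose k) *s (D ^^
      k) x)"
    unfolding Suc by (simp add: Dsum Dscale)
  also have "(\<Sum>k\<le>n. of_nat (n choose k) *s (D ^^ k) x) = (\<Sum>k\<le>Suc n. of_nat (n choose k) *s (D ^^ k)
      x)"
    by (simp add: binomial_eq_0)
  also have "\<dots> = x + (\<Sum>k\<le>n. of_nat (n choose Suc k) *s (D ^^ Suc k) x)"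
    by (subst sum.atMost_Suc_shift) simp
  also have "(\<Sum>k\<le>n. of_nat (n choose k) *s (D ^^ Suc k) x) + (x + (\<Sum>k\<le>n. of_nat (n choose Suc k) *s
      (D ^^ Suc k) x))
      = x + (\<Sum>k\<le>n. of_nat (Suc n choose Suc k) *s (D ^^ Suc k) x)"
    by (simp add: sum.distrib vec.scale_left_distrib)
  also have "\<dots> = (\<Sum>k\<le>Suc n. of_nat (Suc n choose k) *s (D ^^ k) x)"
    by (subst sum.atMost_Suc_shift) simp
  finally show ?case .
qed simp

lemma funpow_prime_diff:
  fixes F :: "'a ^ 4 \<Rightarrow> 'a ^ 4"
  assumes "\<And>x y. F (x + y) = F x + F y" and "\<And>k x. F (k *s x) = k *s F x"
  shows "((\<lambda>x. F x - x) ^^ p) x = (F ^^ p) x - x"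
proof -
  let ?D = "\<lambda>x. F x - x"
  have "(F ^^ p) x = (\<Sum>k\<le>p. of_nat (p choose k) *s (?D ^^ k) x)"
    by (rule funpow_binomial[OF assms])
  also have "\<dots> = (\<Sum>k\<in>{0, p}. of_nat (p choose k) *s (?D ^^ k) x)"
  proof (intro sum.mono_neutral_right ballI)
    fix k assume "k \<in> {..p} - {0, p}"
    then have "p dvd (p choose k)"
      using prime_p by (intro dvd_choose_prime) auto
    then have "of_nat (p choose k) = (0 :: 'a)"
      using CHAR_field of_nat_eq_0_iff_char_dvd by metis
    then show "of_nat (p choose k) *s (?D ^^ k) x = 0" by simp
  qed auto
  also have "\<dots> = x + (?D ^^ p) x" using p_gt_1 by simp
  finally show ?thesis by simp
qed

text \<open>Freshman's dream for the commuting operators \<open>F\<close> and 1, iterated; it turns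
  p-power order of \<open>F\<close> into nilpotency of F - 1.\<close>

lemma funpow_prime_power_diff:
  fixes F :: "'a ^ 4 \<Rightarrow> 'a ^ 4"
  assumes "\<And>x y. F (x + y) = F x + F y" and "\<And>k x. F (k *s x) = k *s F x"
  shows "((\<lambda>x. F x - x) ^^ (p ^ j)) x = (F ^^ (p ^ j)) x - x"
proof (induction j arbitrary: x)
  case (Suc j)
  let ?D = "\<lambda>x. F x - x" and ?F = "F ^^ (p ^ j)"
  have lin: "(F ^^ n) (x + y) = (F ^^ n) x + (F ^^ n) y" "(F ^^ n) (k *s x) = k *s (F ^^ n) x" for n
      k x y
    by (induction n) (simp_all add: assms)
  have "(?D ^^ (p ^ Suc j)) x = ((?D ^^ (p ^ j)) ^^ p) x"
    by (simp add: funpow_mult mult.commute)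
  also have "?D ^^ (p ^ j) = (\<lambda>x. ?F x - x)" using Suc by (intro ext) simp
  also have "((\<lambda>x. ?F x - x) ^^ p) x = (?F ^^ p) x - x"
    by (rule funpow_prime_diff[OF lin])
  also have "?F ^^ p = F ^^ (p ^ Suc j)" by (simp add: funpow_mult mult.commute)
  finally show ?case .
qed simp

text \<open>The base vector is an eigenvector whose eigenvalue is the determinant of the middle
  block M, so nilpotency of \<open>D\<close> makes it 1. Nilpotency also yields a nonzero row vector
  killed by M - 1, and det (M - 1) = det M - tr M + 1 gives the trace.\<close>

lemma similarity_mat_unipotent:
  fixes a b c w x y z :: 'a
  defines "A \<equiv> similarity_mat a b c w x y z"
  assumes fixed: "\<And>v. v $ 4 = 1 \<Longrightarrow> ((\<lambda>v. v v* A) ^^ (p ^ j)) v = v"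
  shows "w * z - x * y = 1" and "w + z = 2"
proof -
  let ?F = "\<lambda>v. v v* A"
  define D where "D v = v v* A - v" for v
  define N where "N = p ^ j"
  have nil: "(D ^^ N) v = 0" if "v $ 4 = 0" for v
  proof -
    have add: "(?F ^^ n) (u + v) = (?F ^^ n) u + (?F ^^ n) v" for n u v
      by (induction n) (simp_all add: vector_matrix_add)
    \<comment> \<open>\<open>fixed\<close> concerns affine vectors only; a vector at infinity is a
      difference of two of them.\<close>
    let ?e = "vector [0, 0, 0, 1] :: 'a ^ 4"
    have "(?F ^^ N) (v + ?e) = v + ?e" "(?F ^^ N) ?e = ?e"
      unfolding N_def by (rule fixed; use that in simp)+
    then have "(?F ^^ N) v = v" unfolding add by simp
    moreover have "(D ^^ N) v = (?F ^^ N) v - v"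
      unfolding D_def[abs_def] N_def by (rule funpow_prime_power_diff) (simp_all add:
          vector_matrix_add vector_matrix_scale)
    ultimately show ?thesis by simp
  qed
  let ?k = "w * z - x * y"
  have "(D ^^ n) (vector [1, 0, 0, 0]) = (?k - 1) ^ n *s vector [1, 0, 0, 0]" for n
  proof (induction n)
    case (Suc n)
    then show ?case by (simp add: D_def vec4_eq_iff vector_matrix_nth A_def similarity_mat_def
        algebra_simps)
  qed (simp add: vec4_eq_iff)
  then have "(?k - 1) ^ N = 0" using nil[of "vector [1, 0, 0, 0]"] by (simp add: vec4_eq_iff)
  then show k: "?k = 1" by simp
  let ?v = "vector [0, 1, 0, 0] :: 'a ^ 4"
  \<comment> \<open>An iterate with nonzero middle part whose successor has middle part 0 provides
    the kernel vector.\<close>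
  define P where "P n \<longleftrightarrow> ((D ^^ n) ?v) $ 2 = 0 \<and> ((D ^^ n) ?v) $ 3 = 0" for n
  have "P N" unfolding P_def using nil[of ?v] by simp
  moreover have "\<not> P 0" by (simp add: P_def)
  ultimately obtain n where n: "\<not> P n" "P (Suc n)"
    using nat_induct[of "\<lambda>n. \<not> P n" N] by blast
  define u where "u = (D ^^ n) ?v"
  have u4: "u $ 4 = 0"
    unfolding u_def by (cases n) (simp_all add: D_def A_def similarity_mat_nth4)
  have "(D u) $ 2 = 0" "(D u) $ 3 = 0" using n(2) by (simp_all add: P_def u_def)
  then have u: "u $ 2 * (w - 1) + u $ 3 * y = 0" "u $ 2 * x + u $ 3 * (z - 1) = 0"
    using u4 by (simp_all add: D_def vector_matrix_nth A_def similarity_mat_def algebra_simps)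
  have "u $ 2 \<noteq> 0 \<or> u $ 3 \<noteq> 0" using n(1) by (auto simp: P_def u_def)
  \<comment> \<open>Cramer's rule: multiplication by the adjugate turns the kernel relation into the
    determinant times \<open>u\<close>.\<close>
  moreover have "u $ 2 * ((w - 1) * (z - 1) - x * y)
      = (z - 1) * (u $ 2 * (w - 1) + u $ 3 * y) - y * (u $ 2 * x + u $ 3 * (z - 1))"
    "u $ 3 * ((w - 1) * (z - 1) - x * y)
      = (w - 1) * (u $ 2 * x + u $ 3 * (z - 1)) - x * (u $ 2 * (w - 1) + u $ 3 * y)"
    by (simp_all add: algebra_simps)
  then have "u $ 2 * ((w - 1) * (z - 1) - x * y) = 0" "u $ 3 * ((w - 1) * (z - 1) - x * y) = 0"
    unfolding u by simp_all
  ultimately have "(w - 1) * (z - 1) - x * y = 0" by auto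
  moreover have "(w - 1) * (z - 1) - x * y = ?k - (w + z) + 1" by (simp add: algebra_simps)
  ultimately have "1 - (w + z) + 1 = 0" using k by simp
  then show "w + z = 2" by (simp add: algebra_simps)
qed

end

text \<open>The common fixed vector is a nonzero row of the nilpotent part of the first block.\<close>

lemma unipotent_common_fixed:
  fixes w x y z W X Y Z :: "'a::field"
  assumes "w * z - x * y = 1" "w + z = 2" "W * Z - X * Y = 1" "W + Z = 2"
    and tr: "(w * W + x * Y) + (y * X + z * Z) = 2"
  shows "x \<noteq> 0 \<Longrightarrow> (w - 1) * W + x * Y = w - 1 \<and> (w - 1) * X + x * Z = x"
    and "x = 0 \<Longrightarrow> y \<noteq> 0 \<Longrightarrow> W = 1 \<and> X = 0"
proof -
  \<comment> \<open>The blocks are 1 + N and 1 + M, where N has rows (e, x), (y, -e) and M has rows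
    (E, X), (Y, -E). Then \<open>xy\<close> expresses det N = det M = 0, and \<open>t\<close> that N
    M has trace 0.\<close>
  define e E where "e = w - 1" and "E = W - 1"
  have w: "w = 1 + e" "z = 1 - e" "W = 1 + E" "Z = 1 - E"
    using assms(2,4) by (simp_all add: e_def E_def algebra_simps)
  have xy: "x * y = - (e * e)" "X * Y = - (E * E)"
    using assms(1,3) unfolding w by (simp_all add: algebra_simps eq_neg_iff_add_eq_0)
  have t: "2 * e * E + x * Y + y * X = 0"
    using tr unfolding w by (simp add: algebra_simps)
  {
    assume x: "x \<noteq> 0"
    \<comment> \<open>The squared minor of the first rows of N and M is a combination of the trace
      of N M and the two determinants.\<close>
    have "(e * X - x * E) * (e * X - x * E) = - (x * X) * (2 * e * E + x * Y + y * X)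
        + x * x * (X * Y + E * E) + X * X * (x * y + e * e)"
      by (simp add: algebra_simps)
    then have "(e * X - x * E) * (e * X - x * E) = 0" unfolding t xy by simp
    then have eX: "e * X = x * E" by simp
    have "x * (x * Y + e * E) = x * (2 * e * E + x * Y + y * X) - X * (x * y + e * e) + e * (e * X -
        x * E)"
      by (simp add: algebra_simps)
    then have "x * (x * Y + e * E) = 0" unfolding t xy eX by simp
    then have "x * Y + e * E = 0" using x by simp
    then show "(w - 1) * W + x * Y = w - 1 \<and> (w - 1) * X + x * Z = x"
      using eX unfolding w by (simp add: algebra_simps)
  }
  {
    assume "x = 0" "y \<noteq> 0"
    then have "e = 0" using xy by simp
    then have "X = 0" using t \<open>x = 0\<close> \<open>y \<noteq> 0\<close> by simp
    then have "E = 0" using xy by simp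
    then show "W = 1 \<and> X = 0" using \<open>X = 0\<close> w by simp
  }
qed

section \<open>Regular linear groups\<close>

lemma BijGroup_mult_apply:
  "f \<in> Bij S \<Longrightarrow> g \<in> Bij S \<Longrightarrow> x \<in> S \<Longrightarrow> (f \<otimes>\<^bsub>BijGroup S\<^esub> g) x = f (g x)"
  by (simp add: BijGroup_def compose_def)

lemma BijGroup_one_apply: "x \<in> S \<Longrightarrow> \<one>\<^bsub>BijGroup S\<^esub> x = x"
  by (simp add: BijGroup_def)

locale linear_regular_group = field_of_order ty p m
  for ty :: "'a::{field,finite} itself" and p m +
  fixes G :: "(('a ^ 4) set \<Rightarrow> ('a ^ 4) set) set"
  assumes G_subgroup: "subgroup G (BijGroup pg_points)"
    and G_linear: "G \<subseteq> PGL4"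
    and G_aut: "\<And>g. g \<in> G \<Longrightarrow> is_payne_automorphism g"
    and G_regular: "acts_regularly_on G payne_points"
begin

abbreviation origin :: "('a ^ 4) set" where
  "origin \<equiv> vec.span {vector [0, 0, 0, 1]}"

lemma G_similarity:
  assumes "g \<in> G"
  obtains a b c w x y z where "g = collineation (similarity_mat a b c w x y z) id"
proof -
  obtain A where "g = collineation A id" "invertible A"
    using assms G_linear by (auto simp: PGL4_def)
  then show thesis
    using payne_automorphism_similarity[of A] G_aut[OF assms] that by metis
qed

lemma G_Bij: "g \<in> G \<Longrightarrow> g \<in> Bij pg_points"
  using subgroup.subset[OF G_subgroup] by (auto simp: BijGroup_def)

lemma G_mult:
  assumes "collineation A id \<in> G" "collineation B id \<in> G"
  shows "collineation (A ** B) id \<in> G"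
  using subgroup.m_closed[OF G_subgroup assms(2,1)] assms by (simp add: collineation_mult G_Bij)

lemma origin_similarity:
  "collineation (similarity_mat a b c w x y z) id origin = vec.span {vector [a, b, c, 1 :: 'a]}"
proof -
  have "vector [0, 0, 0, 1] \<noteq> (0 :: 'a ^ 4)" by (simp add: vec4_eq_iff)
  moreover have "vector [0, 0, 0, 1] v* similarity_mat a b c w x y z = vector [a, b, c, 1]"
    by (simp add: vec4_eq_iff vector_matrix_nth similarity_mat_def)
  ultimately show ?thesis by (simp add: collineation_span)
qed

lemma origin_payne: "origin \<in> payne_points"
  by (simp add: affine_span_payne)

lemma G_transitive:
  obtains w x y z where "collineation (similarity_mat a b c w x y z) id \<in> G"
proof -
  have "vec.span {vector [a, b, c, 1]} \<in> payne_points" by (simp add: affine_span_payne)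
  then obtain g where g: "g \<in> G" "g origin = vec.span {vector [a, b, c, 1]}"
    using G_regular origin_payne unfolding acts_regularly_on_def by metis
  obtain a' b' c' w x y z where g': "g = collineation (similarity_mat a' b' c' w x y z) id"
    using G_similarity[OF g(1)] .
  have "vector [a', b', c', 1] = (vector [a, b, c, 1] :: 'a ^ 4)"
    by (rule span_affine_eq) (use g(2) g' origin_similarity in auto)
  then have "a' = a" "b' = b" "c' = c" by (simp_all add: vec4_eq_iff)
  then show thesis using that g g' by blast
qed

lemma G_unique:
  assumes "collineation (similarity_mat a b c w x y z) id \<in> G" "collineation (similarity_mat a b c
      w' x' y' z') id \<in> G"
  shows "collineation (similarity_mat a b c w x y z) id = collineation (similarity_mat a b c w' x'
      y' z') id"
proof -
  have "vec.span {vector [a, b, c, 1]} \<in> payne_points" by (simp add: affine_span_payne)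
  then have "\<exists>!g. g \<in> G \<and> g origin = vec.span {vector [a, b, c, 1]}"
    by (rule G_regular[unfolded acts_regularly_on_def, rule_format, OF origin_payne])
  then have "g = g'" if "g \<in> G" "g origin = vec.span {vector [a, b, c, 1]}"
    "g' \<in> G" "g' origin = vec.span {vector [a, b, c, 1]}" for g g'
    using that by (metis (no_types, lifting))
  from this[OF assms(1) origin_similarity assms(2) origin_similarity] show ?thesis .
qed

text \<open>Regularity makes evaluation at the origin a bijection onto the affine points, which
  correspond to triples (a, b, c).\<close>

lemma card_G: "card G = p ^ (3 * m)"
proof -
  have "bij_betw (\<lambda>g. g origin) G payne_points"
  proof (rule bij_betwI')
    show "(g origin = g' origin) = (g = g')" if "g \<in> G" "g' \<in> G" for g g'
    proof -
      have "g origin \<in> payne_points"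
        using G_aut[OF that(1)] origin_payne unfolding is_payne_automorphism_def
        by (meson bij_betwE)
      then show ?thesis
        using that G_regular origin_payne unfolding acts_regularly_on_def by metis
    qed
    show "g origin \<in> payne_points" if "g \<in> G" for g
      using G_aut[OF that] origin_payne unfolding is_payne_automorphism_def by (meson bij_betwE)
    show "\<exists>g\<in>G. Q = g origin" if "Q \<in> payne_points" for Q
      using that G_regular origin_payne unfolding acts_regularly_on_def by metis
  qed
  then have "card G = card (payne_points :: ('a ^ 4) set set)" by (rule bij_betw_same_card)
  also have "(payne_points :: ('a ^ 4) set set) = (\<lambda>(a, b, c). vec.span {vector [a, b, c, 1]}) `
      UNIV"
    unfolding payne_points_eq by auto
  also have "card \<dots> = card (UNIV :: ('a \<times> 'a \<times> 'a) set)"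
  proof (rule card_image, rule inj_onI)
    fix s t :: "'a \<times> 'a \<times> 'a"
    assume eq: "(case s of (a, b, c) \<Rightarrow> vec.span {vector [a, b, c, 1] :: 'a ^ 4})
      = (case t of (a, b, c) \<Rightarrow> vec.span {vector [a, b, c, 1]})"
    obtain a b c a' b' c' where st: "s = (a, b, c)" "t = (a', b', c')" by (metis prod_cases3)
    have "vector [a, b, c, 1] = (vector [a', b', c', 1] :: 'a ^ 4)"
      by (rule span_affine_eq) (use eq st in simp_all)
    then show "s = t" by (simp add: st vec4_eq_iff)
  qed
  also have "\<dots> = CARD('a) * (CARD('a) * CARD('a))" by (simp add: card_prod)
  also have "\<dots> = p ^ (m + (m + m))" unfolding card_field by (simp only: power_add)
  also have "m + (m + m) = 3 * m" by simp
  finally show ?thesis .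
qed

text \<open>Lagrange's theorem makes the power trivial on points only; the preserved fourth
  coordinate lifts this from spans to vectors.\<close>

lemma G_power:
  assumes A: "collineation A id \<in> G" and col: "\<And>v. (v v* A) $ 4 = v $ 4" and v: "v $ 4 = 1"
  shows "((\<lambda>v. v v* A) ^^ (p ^ (3 * m))) v = v"
proof -
  let ?B = "BijGroup (pg_points :: ('a ^ 4) set set)"
  let ?K = "?B\<lparr>carrier := G\<rparr>"
  let ?g = "collineation A id" and ?F = "\<lambda>v. v v* A"
  have B: "group ?B" by (rule group_BijGroup)
  then have K: "group ?K" by (rule subgroup.subgroup_is_group[OF G_subgroup])
  have monoid: "monoid ?B" by (rule group.is_monoid[OF B])
  have pg: "vec.span {v} \<in> pg_points" if "v $ 4 = 1" for v :: "'a ^ 4"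
    using that by (intro span_in_pg_points) auto
  have F4: "((?F ^^ n) v) $ 4 = 1" for n by (induction n) (simp_all add: v col)
  have carrier: "carrier ?B = Bij pg_points" by (simp add: BijGroup_def)
  have g_carrier: "?g \<in> carrier ?B" unfolding carrier by (rule G_Bij[OF A])
  have pow_Bij: "?g [^]\<^bsub>?B\<^esub> n \<in> Bij pg_points" for n :: nat
    using monoid.nat_pow_closed[OF monoid g_carrier, of n] unfolding carrier .
  have pow: "(?g [^]\<^bsub>?B\<^esub> n) (vec.span {v}) = vec.span {(?F ^^ n) v}" if "v $ 4 = 1" for n :: nat and
      v
    using that
  proof (induction n arbitrary: v)
    case 0
    then show ?case by (simp add: BijGroup_one_apply pg)
  next
    case (Suc n)
    then have v0: "v \<noteq> 0" by auto
    have "(?g [^]\<^bsub>?B\<^esub> Suc n) (vec.span {v}) = (?g [^]\<^bsub>?B\<^esub> n) (?g (vec.span {v}))"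
      unfolding nat_pow_Suc by (rule BijGroup_mult_apply[OF pow_Bij G_Bij[OF A] pg[OF Suc.prems]])
    also have "?g (vec.span {v}) = vec.span {?F v}" by (rule collineation_span[OF v0])
    also have "(?g [^]\<^bsub>?B\<^esub> n) (vec.span {?F v}) = vec.span {(?F ^^ n) (?F v)}"
      using col Suc.prems by (intro Suc.IH) simp
    also have "(?F ^^ n) (?F v) = (?F ^^ Suc n) v" by (simp only: funpow_Suc_right comp_apply)
    finally show ?case .
  qed
  have "?g [^]\<^bsub>?K\<^esub> order ?K = \<one>\<^bsub>?K\<^esub>" by (rule group.pow_order_eq_1[OF K]) (simp add: A)
  moreover have "order ?K = p ^ (3 * m)" using card_G by (simp add: order_def)
  ultimately have "?g [^]\<^bsub>?B\<^esub> (p ^ (3 * m)) = \<one>\<^bsub>?B\<^esub>"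
    using monoid.nat_pow_consistent[OF monoid, of ?g "p ^ (3 * m)" G] by simp
  then have "vec.span {(?F ^^ (p ^ (3 * m))) v} = vec.span {v}"
    using pow[OF v, of "p ^ (3 * m)"] BijGroup_one_apply[OF pg[OF v]] by simp
  then show ?thesis by (rule span_affine_eq) (simp_all add: F4 v)
qed

lemma G_unipotent:
  assumes "collineation (similarity_mat a b c w x y z) id \<in> G"
  shows "w * z - x * y = 1" and "w + z = 2"
  by (rule similarity_mat_unipotent, rule G_power[OF assms similarity_mat_nth4], assumption)+

text \<open>One element with a nonzero off-diagonal block entry supplies the vector: its products
  with the others lie in \<open>G\<close>, so they too have block trace 2. If all blocks are
  diagonal, determinant 1 and trace 2 make them the identity.\<close>

lemma G_common_fixed:
  obtains v1 v2 where "v1 \<noteq> 0 \<or> v2 \<noteq> 0"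
    "\<And>a b c w x y z. collineation (similarity_mat a b c w x y z) id \<in> G \<Longrightarrow> v1 * w + v2 * y = v1 \<and> v1
        * x + v2 * z = v2"
proof (cases "\<exists>a b c w x y z. collineation (similarity_mat a b c w x y z) id \<in> G \<and> (x \<noteq> 0 \<or> y \<noteq> 0)")
  case False
  show thesis
  proof (rule that[of 1 0])
    fix a b c w x y z
    assume g: "collineation (similarity_mat a b c w x y z) id \<in> G"
    then have xy: "x = 0" "y = 0" using False by blast+
    then have "w * z = 1" "z = 2 - w" using G_unipotent[OF g] by (simp_all add: eq_diff_eq
        add.commute)
    moreover have "(w - 1) * (w - 1) = 1 - w * (2 - w)" by (simp add: algebra_simps)
    ultimately have "(w - 1) * (w - 1) = 0" by simp
    then show "1 * w + 0 * y = 1 \<and> 1 * x + 0 * z = 0" using xy by simp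
  qed simp
next
  case True
  then obtain a b c w x y z where g: "collineation (similarity_mat a b c w x y z) id \<in> G" and xy: "x
      \<noteq> 0 \<or> y \<noteq> 0"
    by blast
  have tr: "(w * W + x * Y) + (y * X + z * Z) = 2" and un: "W * Z - X * Y = 1" "W + Z = 2"
    if "collineation (similarity_mat A B C W X Y Z) id \<in> G" for A B C W X Y Z
    using G_unipotent(2)[OF G_mult[OF g that, unfolded similarity_mat_mult]] G_unipotent[OF that] by
        auto
  show thesis
  proof (cases "x = 0")
    case False
    show thesis
    proof (rule that[of "w - 1" x])
      fix A B C W X Y Z
      assume G: "collineation (similarity_mat A B C W X Y Z) id \<in> G"
      show "(w - 1) * W + x * Y = w - 1 \<and> (w - 1) * X + x * Z = x"
        using unipotent_common_fixed(1)[OF G_unipotent[OF g] un[OF G] tr[OF G] False] .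
    qed (use False in simp)
  next
    case True
    show thesis
    proof (rule that[of 1 0])
      fix A B C W X Y Z
      assume G: "collineation (similarity_mat A B C W X Y Z) id \<in> G"
      have "W = 1 \<and> X = 0"
        using unipotent_common_fixed(2)[OF G_unipotent[OF g] un[OF G] tr[OF G] True] xy True by simp
      then show "1 * W + 0 * Y = 1 \<and> 1 * X + 0 * Z = 0" by simp
    qed simp
  qed
qed

text \<open>Matrices normalized by their last column, so that each element of \<open>G\<close> has exactly one lift.\<close>

definition lifts :: "('a ^ 4 ^ 4) set" where
  "lifts = {A. collineation A id \<in> G \<and> (\<forall>v. (v v* A) $ 4 = v $ 4)}"

lemma similarity_in_lifts: "similarity_mat a b c w x y z \<in> lifts \<longleftrightarrow> collineation (similarity_mat a b
    c w x y z) id \<in> G"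
  by (simp add: lifts_def similarity_mat_nth4)

lemma lifts_similarity:
  assumes "A \<in> lifts"
  obtains a b c w x y z where "A = similarity_mat a b c w x y z"
proof -
  have "collineation A id \<in> G" using assms by (simp add: lifts_def)
  then obtain a b c w x y z where "collineation A id = collineation (similarity_mat a b c w x y z)
      id"
    by (rule G_similarity)
  then have "A = similarity_mat a b c w x y z"
    using assms by (intro collineation_normalized_inj) (simp_all add: lifts_def similarity_mat_nth4)
  then show thesis by (rule that)
qed

lemma G_eq_lifts: "G = (\<lambda>A. collineation A id) ` lifts"
proof
  show "G \<subseteq> (\<lambda>A. collineation A id) ` lifts"
  proof
    fix g assume g: "g \<in> G"
    then obtain a b c w x y z where "g = collineation (similarity_mat a b c w x y z) id" by (rule
        G_similarity)
    then show "g \<in> (\<lambda>A. collineation A id) ` lifts" using g similarity_in_lifts by blast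
  qed
qed (auto simp: lifts_def)

lemma lifts_mult: "A \<in> lifts \<Longrightarrow> B \<in> lifts \<Longrightarrow> A ** B \<in> lifts"
  by (simp add: lifts_def G_mult vector_matrix_matrix)

lemma lifts_unique:
  assumes "similarity_mat a b c w x y z \<in> lifts" "similarity_mat a b c w' x' y' z' \<in> lifts"
  shows "similarity_mat a b c w x y z = similarity_mat a b c w' x' y' z'"
  using assms G_unique[of a b c w x y z w' x' y' z']
  by (intro collineation_normalized_inj) (auto simp: similarity_in_lifts similarity_mat_nth4)

text \<open>With the fixed vector as first row of the block of a base change of determinant 1, each
  conjugated block has first row (1, 0), and determinant 1 leaves (t, 1) as second row. By
  regularity the last row determines the lift, so t is a function of a, b, c.\<close>

lemma lifts_conjugate_to_E:
  obtains v1 v2 u1 u2 T where "v1 * u2 - v2 * u1 = 1"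
    "{similarity_mat 0 0 0 v1 v2 u1 u2 ** A ** similarity_mat 0 0 0 u2 (- v2) (- u1) v1 | A. A \<in>
        lifts}
      = {E_mat a b c (T a b c) | a b c. True}"
    "\<And>a b c x y z. T (a - b * z + c * (y - z * T x y z) + x) (b + c * T x y z + y) (c + z)
       = T a b c + T x y z"
proof -
  obtain v1 v2 where v: "v1 \<noteq> 0 \<or> v2 \<noteq> 0"
    and fixed: "\<And>a b c w x y z. collineation (similarity_mat a b c w x y z) id \<in> G \<Longrightarrow> v1 * w + v2 * y
        = v1 \<and> v1 * x + v2 * z = v2"
    using G_common_fixed by blast
  obtain u1 u2 where u: "v1 * u2 - v2 * u1 = 1"
  proof (cases "v1 = 0")
    case True
    then show thesis using v by (intro that[of 0 "- (1 / v2)"]) auto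
  next
    case False
    then show thesis by (intro that[of "1 / v1" 0]) simp
  qed
  define P where "P = similarity_mat 0 0 0 v1 v2 u1 u2"
  \<comment> \<open>The block is the adjugate of that of \<open>P\<close>, hence its
    inverse.\<close>
  define P' where "P' = similarity_mat 0 0 0 u2 (- v2) (- u1) v1"
  have P'P: "P' ** P = mat 1"
    unfolding P_def P'_def similarity_mat_mult similarity_mat_one[symmetric] using u by (simp add:
        algebra_simps)
  define H where "H = {P ** A ** P' | A. A \<in> lifts}"
  have lower: "\<exists>t. P ** similarity_mat a b c w x y z ** P' = E_mat a (b * u2 - c * u1) (c * v1 - b *
      v2) t"
    if g: "similarity_mat a b c w x y z \<in> lifts" for a b c w x y z
  proof -
    have g: "collineation (similarity_mat a b c w x y z) id \<in> G" using g by (simp add: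
        similarity_in_lifts)
    have fx: "v1 * w + v2 * y = v1" "v1 * x + v2 * z = v2" using fixed[OF g] by auto
    define r where "r = u1 * w + u2 * y"
    define s where "s = u1 * x + u2 * z"
    have PA: "P ** similarity_mat a b c w x y z = similarity_mat a b c v1 v2 r s"
      unfolding P_def similarity_mat_mult fx r_def s_def by simp
    have "v1 * s - v2 * r = (v1 * w + v2 * y) * s - (v1 * x + v2 * z) * r" unfolding fx ..
    also have "\<dots> = (v1 * u2 - v2 * u1) * (w * z - x * y)" by (simp add: r_def s_def algebra_simps)
    finally have vs: "v1 * s - v2 * r = 1" using u G_unipotent[OF g] by simp
    have "similarity_mat a b c v1 v2 r s ** P' = similarity_mat a (b * u2 - c * u1) (c * v1 - b *
        v2)
        1 0 (r * u2 - s * u1) 1"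
    proof -
      have "u2 * v1 - - v2 * - u1 = 1" "v1 * u2 + v2 * - u1 = 1" "v1 * - v2 + v2 * v1 = 0"
        "r * - v2 + s * v1 = 1" using u vs by (simp_all add: mult.commute)
      then show ?thesis unfolding P'_def similarity_mat_mult by simp
    qed
    then show ?thesis unfolding PA similarity_mat_eq_E_mat by blast
  qed
  have ex: "\<exists>t. E_mat a b c t \<in> H" for a b c
  proof -
    \<comment> \<open>The last row is chosen so that the base change by \<open>P'\<close> returns
      (b, c).\<close>
    obtain w x y z where L: "similarity_mat a (b * v1 + c * u1) (b * v2 + c * u2) w x y z \<in> lifts"
      using G_transitive similarity_in_lifts by metis
    have "(b * v1 + c * u1) * u2 - (b * v2 + c * u2) * u1 = b * (v1 * u2 - v2 * u1)"
      "(b * v2 + c * u2) * v1 - (b * v1 + c * u1) * v2 = c * (v1 * u2 - v2 * u1)"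
      by (simp_all add: algebra_simps)
    then have bc: "(b * v1 + c * u1) * u2 - (b * v2 + c * u2) * u1 = b"
      "(b * v2 + c * u2) * v1 - (b * v1 + c * u1) * v2 = c" using u by simp_all
    obtain t where "P ** similarity_mat a (b * v1 + c * u1) (b * v2 + c * u2) w x y z ** P' = E_mat
        a b c t"
      using lower[OF L] unfolding bc by blast
    then show ?thesis using L unfolding H_def by (metis (mono_tags, lifting) mem_Collect_eq)
  qed
  have H_cases: "\<exists>a b c t. B = E_mat a b c t" if "B \<in> H" for B
  proof -
    obtain A where A: "B = P ** A ** P'" "A \<in> lifts" using \<open>B \<in> H\<close> by (auto simp: H_def)
    from A(2) obtain a b c w x y z where "A = similarity_mat a b c w x y z" by (rule
        lifts_similarity)
    then show ?thesis using lower A by blast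
  qed
  have uniq: "t = t'" if tt: "E_mat a b c t \<in> H" "E_mat a b c t' \<in> H" for a b c t t'
  proof -
    have *: "\<exists>w x y z. similarity_mat a (b * v1 + c * u1) (b * v2 + c * u2) w x y z \<in> lifts
        \<and> E_mat a b c t = P ** similarity_mat a (b * v1 + c * u1) (b * v2 + c * u2) w x y z ** P'"
      if t: "E_mat a b c t \<in> H" for t
    proof -
      obtain A where A: "E_mat a b c t = P ** A ** P'" "A \<in> lifts" using t by (auto simp: H_def)
      obtain a' b' c' w x y z where A': "A = similarity_mat a' b' c' w x y z" using
          lifts_similarity[OF A(2)] .
      obtain t' where "E_mat a b c t = E_mat a' (b' * u2 - c' * u1) (c' * v1 - b' * v2) t'"
        using lower A A' by metis
      then have "(E_mat a b c t) $ 4 $ j = (E_mat a' (b' * u2 - c' * u1) (c' * v1 - b' * v2) t') $ 4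
          $ j" for j
        by simp
      from this[of 1] this[of 2] this[of 3]
      have abc: "a = a'" "b = b' * u2 - c' * u1" "c = c' * v1 - b' * v2"
        by (simp_all add: E_mat_def)
      have "b * v1 + c * u1 = b' * (v1 * u2 - v2 * u1)" "b * v2 + c * u2 = c' * (v1 * u2 - v2 * u1)"
        unfolding abc by (simp_all add: algebra_simps)
      then have "b * v1 + c * u1 = b'" "b * v2 + c * u2 = c'" using u by simp_all
      then show ?thesis using A A' abc(1) by blast
    qed
    have "E_mat a b c t = E_mat a b c t'"
      using *[OF tt(1)] *[OF tt(2)] lifts_unique by metis
    then have "(E_mat a b c t) $ 3 $ 2 = (E_mat a b c t') $ 3 $ 2" by simp
    then show ?thesis by (simp add: E_mat_def)
  qed
  define T where "T a b c = (SOME t. E_mat a b c t \<in> H)" for a b c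
  have T_in: "E_mat a b c (T a b c) \<in> H" for a b c
    unfolding T_def using someI_ex[OF ex] .
  have T_eq: "t = T a b c" if "E_mat a b c t \<in> H" for a b c t
    using uniq[OF that T_in] .
  have H_mult: "B ** C \<in> H" if "B \<in> H" "C \<in> H" for B C
  proof -
    obtain A A' where A: "B = P ** A ** P'" "C = P ** A' ** P'" "A \<in> lifts" "A' \<in> lifts"
      using \<open>B \<in> H\<close> \<open>C \<in> H\<close> by (auto simp: H_def)
    have "B ** C = P ** (A ** ((P' ** P) ** A')) ** P'"
      unfolding A by (simp only: matrix_mul_assoc)
    then have "B ** C = P ** (A ** A') ** P'" by (simp add: P'P)
    then show ?thesis using A lifts_mult unfolding H_def by blast
  qed
  show thesis
  proof (rule that[OF u])
    show "{similarity_mat 0 0 0 v1 v2 u1 u2 ** A ** similarity_mat 0 0 0 u2 (- v2) (- u1) v1 | A. A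
        \<in> lifts}
      = {E_mat a b c (T a b c) | a b c. True}"
      unfolding P_def[symmetric] P'_def[symmetric] H_def[symmetric]
    proof
      show "H \<subseteq> {E_mat a b c (T a b c) | a b c. True}"
      proof
        fix B assume B: "B \<in> H"
        then obtain a b c t where "B = E_mat a b c t" using H_cases by blast
        then show "B \<in> {E_mat a b c (T a b c) | a b c. True}" using T_eq B by blast
      qed
    qed (use T_in in auto)
    fix a b c x y z
    let ?s = "T x y z"
    \<comment> \<open>Under multiplication the \<open>T\<close>-entries add; uniqueness of the entry
      turns this into the functional equation.\<close>
    have "E_mat a b c (T a b c) ** E_mat x y z ?s
        = E_mat (a - b * z + c * (y - z * ?s) + x) (b + c * ?s + y) (c + z) (T a b c + ?s)"
      unfolding similarity_mat_eq_E_mat[symmetric] similarity_mat_mult by simp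
    then have "E_mat (a - b * z + c * (y - z * ?s) + x) (b + c * ?s + y) (c + z) (T a b c + ?s) \<in> H"
      using H_mult[OF T_in T_in] by metis
    from T_eq[OF this]
    show "T (a - b * z + c * (y - z * ?s) + x) (b + c * ?s + y) (c + z) = T a b c + ?s" ..
  qed
qed

text \<open>Composition reverses matrix products, which is why the conjugating element comes from
  \<open>P'\<close> and not from \<open>P\<close>.\<close>

lemma conjugate_G:
  assumes P: "P ** P' = mat 1" "P' ** P = mat 1"
  shows "conjugate_set (BijGroup pg_points) (collineation P' id) G
    = (\<lambda>A. collineation A id) ` {P ** A ** P' | A. A \<in> lifts}"
proof -
  let ?B = "BijGroup (pg_points :: ('a ^ 4) set set)"
  have B: "group ?B" by (rule group_BijGroup)
  have carr: "carrier ?B = Bij pg_points" by (simp add: BijGroup_def)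
  have Bij: "collineation P id \<in> Bij pg_points" "collineation P' id \<in> Bij pg_points"
    using collineation_in_Bij P by blast+
  have inv: "inv\<^bsub>?B\<^esub> (collineation P' id) = collineation P id"
    by (rule group.inv_equality[OF B]) (simp_all add: carr Bij collineation_mult P
        collineation_mat_1)
  have "collineation P' id \<otimes>\<^bsub>?B\<^esub> collineation A id \<otimes>\<^bsub>?B\<^esub> collineation P id
      = collineation (P ** A ** P') id" if "A \<in> lifts" for A
  proof -
    have A: "collineation A id \<in> Bij pg_points" using that G_Bij by (simp add: lifts_def)
    have "collineation (A ** P') id \<in> Bij pg_points"
      using monoid.m_closed[OF group.is_monoid[OF B], of "collineation P' id" "collineation A id"] A
          Bij
      by (simp add: carr collineation_mult)
    then show ?thesis by (simp add: collineation_mult A Bij matrix_mul_assoc)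
  qed
  then show ?thesis
    unfolding conjugate_set_def inv by (subst G_eq_lifts) (auto simp: image_def)
qed

theorem conjugate_to_construction:
  assumes "p = 2 \<Longrightarrow> m > 1"
  shows "\<exists>h\<in>PGammaSp4_P.
    conjugate_set (BijGroup pg_points) h G \<in> constructionA p m \<union> constructionE p m"
proof -
  obtain v1 v2 u1 u2 T where det: "v1 * u2 - v2 * u1 = 1"
    and H: "{similarity_mat 0 0 0 v1 v2 u1 u2 ** A ** similarity_mat 0 0 0 u2 (- v2) (- u1) v1 | A.
        A \<in> lifts}
      = {E_mat a b c (T a b c) | a b c. True}"
    and T: "\<And>a b c x y z. T (a - b * z + c * (y - z * T x y z) + x) (b + c * T x y z + y) (c + z)
       = T a b c + T x y z"
    by (rule lifts_conjugate_to_E) blast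
  define P where "P = similarity_mat 0 0 0 v1 v2 u1 u2"
  define P' where "P' = similarity_mat 0 0 0 u2 (- v2) (- u1) v1"
  have PP': "P ** P' = mat 1" "P' ** P = mat 1"
    unfolding P_def P'_def similarity_mat_mult similarity_mat_one[symmetric] using det by (simp_all
        add: algebra_simps)
  have "collineation P' id \<in> PGammaSp4"
  proof -
    have "invertible P'" using PP' by (auto simp: invertible_def)
    moreover have "id \<in> field_automorphisms" by (simp add: field_automorphisms_def)
    \<comment> \<open>The multiplier is the determinant of the middle block, here 1.\<close>
    moreover have "sympl_form (semilinear P' id x) (semilinear P' id y) = 1 * id (sympl_form x y)"
        for x y
    proof -
      have "sympl_form (semilinear P' id x) (semilinear P' id y)
          = (v1 * u2 - v2 * u1) * sympl_form x y"
        by (simp add: semilinear_def sympl_form_def vector_matrix_nth P'_def similarity_mat_def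
            algebra_simps)
      then show ?thesis using det by simp
    qed
    ultimately show ?thesis unfolding PGammaSp4_def using one_neq_zero by blast
  qed
  moreover have "collineation P' id base_point = base_point"
  proof -
    have "(vector [1, 0, 0, 0] :: 'a ^ 4) \<noteq> 0" by (simp add: vec4_eq_iff)
    moreover have "vector [1, 0, 0, 0] v* P' = vector [1, 0, 0, 0]"
      using det by (simp add: vec4_eq_iff vector_matrix_nth P'_def similarity_mat_def mult.commute)
    ultimately show ?thesis unfolding base_point_def by (simp add: collineation_span)
  qed
  ultimately have h: "collineation P' id \<in> PGammaSp4_P" by (simp add: PGammaSp4_P_def)
  have conj: "conjugate_set (BijGroup pg_points) (collineation P' id) G = G_set T (\<lambda>a b c. id)"
    using conjugate_G[OF PP'] unfolding H[folded P_def P'_def] G_set_def by auto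
  have "G_set T (\<lambda>a b c. id) \<in> constructionA p m \<union> constructionE p m"
    using T_classification[OF assms T]
  proof
    assume "\<exists>s. T = (\<lambda>a b c. \<Sum>i<m. s i * c ^ p ^ i)"
    then show ?thesis unfolding constructionA_def by blast
  next
    assume "p = 2 \<and> (\<exists>\<omega> \<mu> f s. constructionE_params m \<omega> \<mu> f s \<and> T = constructionE_T m \<omega> \<mu> f s)"
    then show ?thesis unfolding constructionE_def using assms by blast
  qed
  then show ?thesis using h conj by metis
qed

end

theorem theorem4p1:
  fixes G :: "(('a::{field,finite} ^ 4) set \<Rightarrow> ('a ^ 4) set) set"
    and p m :: nat
  assumes "prime p"
    and "CARD('a) = p ^ m"
    and "CARD('a) \<ge> 5"
    and "subgroup G (BijGroup pg_points)"
    and "G \<subseteq> PGL4"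
    and "\<forall>g\<in>G. is_payne_automorphism g"
    and "acts_regularly_on G payne_points"
  shows "\<exists>h\<in>PGammaSp4_P.
    conjugate_set (BijGroup pg_points) h G \<in> constructionA p m \<union> constructionE p m"
proof -
  interpret linear_regular_group "TYPE('a)" p m G
    by (intro linear_regular_group.intro field_of_order.intro linear_regular_group_axioms.intro)
       (use assms in blast)+
  \<comment> \<open>Construction E requires \<open>m > 1\<close>; the bound on the field order
    excludes the field with two elements.\<close>
  have "m > 1" if "p = 2"
  proof (rule ccontr)
    assume "\<not> m > 1"
    then have "(2 :: nat) ^ m \<le> 2 ^ 1" by (intro power_increasing) auto
    then show False using assms(2,3) that by simp
  qed
  then show ?thesis by (rule conjugate_to_construction)
qed

end
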